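(* Let $n\ge 3$, let $M,N\in\mathbb{Z}^{n-1}$ and let $D=(D_1,\dots,D_{n-1})$ be a tuple of positive integers. If $\gcd(D_1,D_2\cdots D_{n-1})=1$, then the long Weyl element Kloosterman sums satisfy $$S_n(M,N;D)=S_2(D_2M_1,N_1;D_1)\cdot S_{n-1}\big(M'',(N_2,\dots,N_{n-1});(D_2,\dots,D_{n-1})\big),$$ where $M''=(D_1M_2,M_3,\dots,M_{n-1})$.
   Context: Definition of $S_n(M,N;D)$ for any $n\ge2$, $M,N\in\mathbb{Z}^{n-1}$ and $D$ an $(n-1)$-tuple of positive integers: $e(z)=e^{2\pi i z}$. $U$ is the group of upper triangular unipotent $n\times n$ matrices. For $N\in\mathbb{Z}^{n-1}$, $\psi_N$ is the character of $U(\mathbb{R})$, trivial on $U(\mathbb{Z})$, given by $\psi_N(u)=e(N_1u_{1,2}+N_2u_{2,3}+\cdots+N_{n-1}u_{n-1,n})$. For $M\in \mathbb{Z}^{n-1}$, $\tilde M=(M_{n-1},\dots,M_1)$. Let $w_0$ be the long Weyl element: the $n\times n$ matrix whose only nonzero entries are on the anti-diagonal, the entry at position $(n-k+1,k)$ being $(-1)^{k-1}$ ($1\le k\le n$). Let $c=\mathrm{Diag}(1/D_{n-1},\,D_{n-1}/D_{n-2},\dots,D_2/D_1,\,D_1)$, $C(c)=U(\mathbb{R})\,c\,w_0\,U(\mathbb{R})\cap SL(n,\mathbb{Z})$ and $X(c)=U(\mathbb{Z})\backslash C(c)/U(\mathbb{Z})$. Each $\gamma\in C(c)$ is uniquely $\gamma=b_1cw_0b_2$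 with $b_1,b_2\in U(\mathbb{R})$; set $\mu(\gamma)=b_1\in U(\mathbb{Z})\backslash U(\mathbb{R})$ and $\mu'(\gamma)=b_2\in U(\mathbb{R})/U(\mathbb{Z})$. Then $$S_n(M,N;D)=\sum_{x\in X(c)}\psi_{\tilde M}(\mu(x))\,\psi_N(\mu'(x)).$$ For $n=2$ the arguments are integers (1-tuples). *)

theory Defs
  imports Complex_Main "Jordan_Normal_Form.Determinant"
begin

text \<open>
  Tuples in the \<open>(n - 1)\<close>-fold product of the integers are lists of length \<open>n - 1\<close>, so the paper's
  \<open>M\<^sub>i\<close> is \<open>M ! (i - 1)\<close>; matrix indices likewise start at \<open>0\<close> here and at \<open>1\<close> in the paper.
  The sum is taken over all double cosets, of which there are finitely many.
\<close>

definition e :: "real \<Rightarrow> complex" where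
  "e x = exp (2 * of_real pi * \<i> * of_real x)"

definition U_real :: "nat \<Rightarrow> real mat set" where
  "U_real n = {u \<in> carrier_mat n n. upper_triangular u \<and> (\<forall>i<n. u $$ (i, i) = 1)}"

definition U_int :: "nat \<Rightarrow> real mat set" where
  "U_int n = {u \<in> U_real n. elements_mat u \<subseteq> \<int>}"

definition SL_int :: "nat \<Rightarrow> real mat set" where
  "SL_int n = {g \<in> carrier_mat n n. elements_mat g \<subseteq> \<int> \<and> det g = 1}"

definition psi :: "nat \<Rightarrow> int list \<Rightarrow> real mat \<Rightarrow> complex" where
  "psi n N u = e (\<Sum>i<n - 1. of_int (N ! i) * u $$ (i, i + 1))"

definition long_weyl :: "nat \<Rightarrow> real mat" where
  "long_weyl n = Matrix.mat n n (\<lambda>(i, j). if i + j = n - 1 then (-1) ^ j else 0)"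

text \<open>With the convention \<open>D\<^sub>0 = D\<^sub>n = 1\<close>, the \<open>k\<close>-th diagonal entry of \<open>c\<close> (for \<open>k = 1, \<dots>, n\<close>) is
  the quotient of \<open>D\<close> at \<open>n - k + 1\<close> by \<open>D\<close> at \<open>n - k\<close>; the list \<open>1 # D @ [1]\<close> holds \<open>D\<^sub>0, \<dots>, D\<^sub>n\<close>.\<close>

definition c_mat :: "nat \<Rightarrow> int list \<Rightarrow> real mat" where
  "c_mat n D = mat_diag n (\<lambda>i. of_int ((1 # D @ [1]) ! (n - i)) / of_int ((1 # D @ [1]) ! (n - i - 1)))"

definition bruhat_cell :: "nat \<Rightarrow> int list \<Rightarrow> real mat set" where
  "bruhat_cell n D =
     {b1 * c_mat n D * long_weyl n * b2 | b1 b2. b1 \<in> U_real n \<and> b2 \<in> U_real n} \<inter> SL_int n"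

definition mu :: "nat \<Rightarrow> int list \<Rightarrow> real mat \<Rightarrow> real mat" where
  "mu n D g = (THE b1. b1 \<in> U_real n \<and> (\<exists>b2 \<in> U_real n. g = b1 * c_mat n D * long_weyl n * b2))"

definition mu' :: "nat \<Rightarrow> int list \<Rightarrow> real mat \<Rightarrow> real mat" where
  "mu' n D g = (THE b2. b2 \<in> U_real n \<and> (\<exists>b1 \<in> U_real n. g = b1 * c_mat n D * long_weyl n * b2))"

definition double_coset :: "nat \<Rightarrow> real mat \<Rightarrow> real mat set" where
  "double_coset n g = {u * g * v | u v. u \<in> U_int n \<and> v \<in> U_int n}"

definition X_set :: "nat \<Rightarrow> int list \<Rightarrow> real mat set set" where
  "X_set n D = double_coset n ` bruhat_cell n D"

text \<open>Passing from \<open>g\<close> to \<open>u * g * v\<close> with \<open>u\<close>, \<open>v\<close> in \<open>U_int n\<close> replaces \<open>mu n D g\<close> by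
  \<open>u * mu n D g\<close> and \<open>mu' n D g\<close> by \<open>mu' n D g * v\<close>. The characters \<open>psi\<close> are trivial on \<open>U_int n\<close>,
  so the summand does not depend on the representative chosen by \<open>SOME\<close>.\<close>

definition kloosterman :: "nat \<Rightarrow> int list \<Rightarrow> int list \<Rightarrow> int list \<Rightarrow> complex" where
  "kloosterman n M N D =
     (\<Sum>x \<in> X_set n D. let g = (SOME g. g \<in> x) in psi n (rev M) (mu n D g) * psi n N (mu' n D g))"

end

theory Submission
  imports Defs
begin

text \<open>
  By uniqueness of the Bruhat decomposition, an element of the cell is a pair \<open>(b\<^sub>1, b\<^sub>2)\<close> of real unipotent
  matrices such that \<open>b\<^sub>1 c w\<^sub>0 b\<^sub>2\<close> is integral, and its double coset is determined by \<open>b\<^sub>1\<close> modulo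
  \<open>U(\<int>)\<close>. Let \<open>\<gamma>\<close> be such an element, with \<open>x\<close> the last but one entry of its first column and \<open>y\<close> the
  second entry of its last row. The lower left \<open>2 \<times> 2\<close> minor of \<open>\<gamma>\<close> is \<open>D\<^sub>2\<close>, so
  \<open>x y \<equiv> D\<^sub>2\<close> modulo \<open>D\<^sub>1\<close>. Since \<open>D\<^sub>1\<close> and \<open>D\<^sub>2\<close> are coprime, so are \<open>x\<close> and \<open>D\<^sub>1\<close>, and so are \<open>y\<close> and
  \<open>D\<^sub>1\<close>. Hence every double coset has a representative with first column \<open>(0, \<dots>, 0, x, D\<^sub>1)\<close>, last row
  \<open>(D\<^sub>1, y, 0, \<dots>, 0)\<close> and \<open>D\<^sub>2\<close> dividing \<open>x\<close>. The pair \<open>(x / D\<^sub>2, y)\<close>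
  is the datum of an element of the cell of \<open>SL\<^sub>2\<close> with modulus \<open>D\<^sub>1\<close>. Clearing the first column and
  the last row over \<open>\<rat>\<close> leaves an \<open>(n - 1) \<times> (n - 1)\<close> block; changing its sign and multiplying its last
  row by \<open>D\<^sub>1\<close> turns it into an integral matrix in the cell with moduli \<open>D\<^sub>2, \<dots>, D\<^sub>n\<^sub>-\<^sub>1\<close>.
  This is a bijection on double cosets; multiplying the last row by \<open>D\<^sub>1\<close> accounts for the
  factor \<open>D\<^sub>1\<close> on \<open>M\<^sub>2\<close>, and the division of \<open>x\<close> by \<open>D\<^sub>2\<close> for the factor \<open>D\<^sub>2\<close> on \<open>M\<^sub>1\<close>.
\<close>

subsection \<open>Unipotent matrices\<close>

lemma elements_mat_subset_iff:
  assumes "A \<in> carrier_mat nr nc"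
  shows "elements_mat A \<subseteq> S \<longleftrightarrow> (\<forall>i<nr. \<forall>j<nc. A $$ (i, j) \<in> S)"
  using assms by (auto 0 4 dest!: elements_matD intro: elements_matI)

lemma U_realD:
  assumes "u \<in> U_real n"
  shows "u \<in> carrier_mat n n" "dim_row u = n" "dim_col u = n"
    "\<And>i. i < n \<Longrightarrow> u $$ (i, i) = 1" "\<And>i j. j < i \<Longrightarrow> i < n \<Longrightarrow> u $$ (i, j) = 0"
  using assms by (auto simp: U_real_def)

lemma U_realI:
  assumes "u \<in> carrier_mat n n" "\<And>i. i < n \<Longrightarrow> u $$ (i, i) = 1"
    "\<And>i j. j < i \<Longrightarrow> i < n \<Longrightarrow> u $$ (i, j) = 0"
  shows "u \<in> U_real n"
  using assms by (auto simp: U_real_def)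

lemma U_int_iff: "u \<in> U_int n \<longleftrightarrow> u \<in> U_real n \<and> (\<forall>i<n. \<forall>j<n. u $$ (i, j) \<in> \<int>)"
  unfolding U_int_def using elements_mat_subset_iff[of u n n "\<int>"] U_realD(1)[of u n] by blast

lemma mult_entry:
  assumes "A \<in> carrier_mat n m" "B \<in> carrier_mat m p" "i < n" "j < p"
  shows "(A * B) $$ (i, j) = (\<Sum>l<m. A $$ (i, l) * B $$ (l, j))"
  using assms by (simp add: scalar_prod_def lessThan_atLeast0)

lemma U_real_one: "1\<^sub>m n \<in> U_real n"
  by (rule U_realI) auto

lemma U_real_mult_entry:
  assumes "u \<in> U_real n" "B \<in> carrier_mat n p" "i < n" "j < p"
  shows "(u * B) $$ (i, j) = B $$ (i, j) + (\<Sum>l\<in>{i<..<n}. u $$ (i, l) * B $$ (l, j))"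
proof -
  have "(u * B) $$ (i, j) = (\<Sum>l<n. u $$ (i, l) * B $$ (l, j))"
    using assms U_realD(1) by (intro mult_entry) auto
  also have "\<dots> = (\<Sum>l\<in>insert i {i<..<n}. u $$ (i, l) * B $$ (l, j))"
    using assms U_realD[OF assms(1)] by (intro sum.mono_neutral_right) (auto simp: not_less)
  also have "\<dots> = B $$ (i, j) + (\<Sum>l\<in>{i<..<n}. u $$ (i, l) * B $$ (l, j))"
    using U_realD(4)[OF assms(1,3)] by simp
  finally show ?thesis .
qed

lemma U_real_mult:
  assumes "u \<in> U_real n" "v \<in> U_real n"
  shows "u * v \<in> U_real n"
proof (rule U_realI)
  note u = U_realD[OF assms(1)] and v = U_realD[OF assms(2)]
  show "u * v \<in> carrier_mat n n" using u v by auto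
  show "(u * v) $$ (i, i) = 1" if "i < n" for i
    using v that by (simp add: U_real_mult_entry[OF assms(1) v(1)])
  show "(u * v) $$ (i, j) = 0" if "j < i" "i < n" for i j
    using v that by (simp add: U_real_mult_entry[OF assms(1) v(1)])
qed

lemma U_real_mult_superdiag:
  assumes "u \<in> U_real n" "v \<in> U_real n" "Suc i < n"
  shows "(u * v) $$ (i, Suc i) = u $$ (i, Suc i) + v $$ (i, Suc i)"
proof -
  note v = U_realD[OF assms(2)]
  have "(\<Sum>l\<in>{i<..<n}. u $$ (i, l) * v $$ (l, Suc i)) = (\<Sum>l\<in>{Suc i}. u $$ (i, l) * v $$ (l, Suc i))"
    using assms(3) v by (intro sum.mono_neutral_right) auto
  thus ?thesis using assms(3) v by (simp add: U_real_mult_entry[OF assms(1) v(1)])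
qed

lemma det_U_real:
  assumes "u \<in> U_real n"
  shows "det u = 1"
proof -
  have "upper_triangular u" using assms by (auto simp: U_real_def)
  from det_upper_triangular[OF this U_realD(1)[OF assms]]
  show ?thesis using U_realD[OF assms] by (simp add: prod_list_diag_prod)
qed

text \<open>The adjugate is a two-sided inverse because the determinant is 1. It remains to see that
  it is again upper triangular with unit diagonal.\<close>

lemma U_real_inverse:
  assumes "u \<in> U_real n"
  obtains v where "v \<in> U_real n" "u * v = 1\<^sub>m n" "v * u = 1\<^sub>m n"
proof -
  define v where "v = adj_mat u"
  note u = U_realD[OF assms]
  have v: "v \<in> carrier_mat n n" "u * v = 1\<^sub>m n" "v * u = 1\<^sub>m n"
    using adj_mat[OF u(1)] det_U_real[OF assms] u(1) by (auto simp: v_def)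
  have ent: "(v * u) $$ (i, j) = (\<Sum>l<j. v $$ (i, l) * u $$ (l, j)) + v $$ (i, j)"
    if "i < n" "j < n" for i j
  proof -
    have "(v * u) $$ (i, j) = (\<Sum>l<n. v $$ (i, l) * u $$ (l, j))"
      using mult_entry[OF v(1) u(1)] that by simp
    also have "\<dots> = (\<Sum>l<Suc j. v $$ (i, l) * u $$ (l, j))"
      using that u by (intro sum.mono_neutral_right) auto
    finally show ?thesis using that u by simp
  qed
  \<comment> \<open>By \<open>ent\<close>, the equation \<open>v * u = 1\<close> expresses
    \<open>v $$ (i, j)\<close> through the entries of row \<open>i\<close> in earlier columns, and
    those vanish by induction.\<close>
  have low: "j < i \<Longrightarrow> i < n \<Longrightarrow> v $$ (i, j) = 0" for i j
  proof (induction j rule: less_induct)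
    case (less j)
    have "(\<Sum>l<j. v $$ (i, l) * u $$ (l, j)) = 0"
      using less by (intro sum.neutral) auto
    thus ?case using ent[of i j] less.prems v(3) by simp
  qed
  have "v \<in> U_real n"
  proof (rule U_realI)
    show "v $$ (i, i) = 1" if "i < n" for i
      using ent[of i i] that low v(3) by simp
  qed (use v low in auto)
  thus thesis using v that by blast
qed

section \<open>Integrality of products, determinants and inverses\<close>

lemma Ints_mult_mat:
  assumes "A \<in> carrier_mat n m" "B \<in> carrier_mat m p"
    and "elements_mat A \<subseteq> \<int>" "elements_mat B \<subseteq> (\<int> :: real set)"
  shows "elements_mat (A * B) \<subseteq> \<int>"
proof -
  have "A * B \<in> carrier_mat n p" using assms by auto
  moreover have "\<forall>i<n. \<forall>j<m. A $$ (i, j) \<in> \<int>" "\<forall>i<m. \<forall>j<p. B $$ (i, j) \<in> \<int>"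
    using assms by (simp_all add: elements_mat_subset_iff)
  hence "(A * B) $$ (i, j) \<in> \<int>" if "i < n" "j < p" for i j
    unfolding mult_entry[OF assms(1,2) that] using that by (intro Ints_sum Ints_mult) auto
  ultimately show ?thesis by (simp add: elements_mat_subset_iff del: index_mult_mat)
qed

lemma Ints_det:
  assumes "A \<in> carrier_mat n n" "elements_mat A \<subseteq> (\<int> :: real set)"
  shows "det A \<in> \<int>"
proof -
  have "\<forall>i<n. \<forall>j<n. A $$ (i, j) \<in> \<int>" using assms by (simp add: elements_mat_subset_iff)
  moreover have "p i < n" if "p permutes {0..<n}" "i < n" for p i
    using permutes_in_image[OF that(1), of i] that(2) by simp
  ultimately show ?thesis
    unfolding det_def'[OF assms(1)]
    by (intro Ints_sum Ints_mult Ints_of_int Ints_prod) auto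
qed

lemma Ints_adj_mat:
  assumes "A \<in> carrier_mat n n" "elements_mat A \<subseteq> (\<int> :: real set)"
  shows "elements_mat (adj_mat A) \<subseteq> \<int>"
proof -
  have del: "det (mat_delete A j i) \<in> \<int>" if "i < n" "j < n" for i j
  proof (rule Ints_det)
    show "mat_delete A j i \<in> carrier_mat (n - 1) (n - 1)" using assms by auto
    thus "elements_mat (mat_delete A j i) \<subseteq> \<int>"
      using assms that by (auto simp: elements_mat_subset_iff mat_delete_def)
  qed
  have "adj_mat A \<in> carrier_mat n n" using adj_mat(1)[OF assms(1)] .
  moreover have "adj_mat A $$ (i, j) \<in> \<int>" if "i < n" "j < n" for i j
    using that assms(1) del[OF that] by (auto simp: adj_mat_def cofactor_def intro!: Ints_mult Ints_power)
  ultimately show ?thesis by (auto simp: elements_mat_subset_iff)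
qed

text \<open>An integral matrix of determinant 1 has its integral adjugate as inverse, so
  \<open>h\<close> can be cancelled from \<open>h * v\<close> without leaving the integers.\<close>

lemma Ints_right_factor:
  assumes "h \<in> carrier_mat n n" "elements_mat h \<subseteq> \<int>" "det h = (1 :: real)"
    and "v \<in> carrier_mat n n" "elements_mat (h * v) \<subseteq> \<int>"
  shows "elements_mat v \<subseteq> \<int>"
proof -
  note adj = adj_mat[OF assms(1)]
  have "adj_mat h * (h * v) = (adj_mat h * h) * v"
    using adj assms by (intro assoc_mult_mat[symmetric]) auto
  also have "adj_mat h * h = 1\<^sub>m n" using adj(3) assms(3) by (intro eq_matI) auto
  also have "1\<^sub>m n * v = v" using assms by simp
  finally have *: "adj_mat h * (h * v) = v" .
  have "elements_mat (adj_mat h * (h * v)) \<subseteq> \<int>"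
  proof (rule Ints_mult_mat)
    show "h * v \<in> carrier_mat n n" using assms by auto
  qed (use assms adj(1) Ints_adj_mat[OF assms(1,2)] in blast)+
  thus ?thesis unfolding * .
qed

lemma U_int_subset: "u \<in> U_int n \<Longrightarrow> u \<in> U_real n"
  by (simp add: U_int_def)

lemma U_int_one: "1\<^sub>m n \<in> U_int n"
  by (auto simp: U_int_iff U_real_one)

lemma U_int_mult: "u \<in> U_int n \<Longrightarrow> v \<in> U_int n \<Longrightarrow> u * v \<in> U_int n"
  unfolding U_int_def using U_real_mult Ints_mult_mat U_realD(1) by blast

lemma U_int_inverse:
  assumes "u \<in> U_int n"
  obtains v where "v \<in> U_int n" "u * v = 1\<^sub>m n" "v * u = 1\<^sub>m n"
proof -
  obtain v where v: "v \<in> U_real n" "u * v = 1\<^sub>m n" "v * u = 1\<^sub>m n"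
    using U_real_inverse U_int_subset[OF assms] by blast
  have "elements_mat v \<subseteq> \<int>"
  proof (rule Ints_right_factor[of u n])
    show "elements_mat (u * v) \<subseteq> \<int>" using U_int_one[of n] v by (simp add: U_int_def)
  qed (use assms v(1) det_U_real[of u n] U_realD(1) in \<open>auto simp: U_int_def\<close>)
  thus thesis using that v by (auto simp: U_int_def)
qed

section \<open>The characters of the unipotent group\<close>

lemma e_add: "e (x + y) = e x * e y"
  by (simp add: e_def exp_add[symmetric] algebra_simps)

lemma e_Ints:
  assumes "x \<in> \<int>"
  shows "e x = 1"
proof -
  from assms obtain k where "x = of_int k" by (rule Ints_cases)
  thus ?thesis using cis_multiple_2pi[of "of_int k"] by (simp add: e_def cis_conv_exp mult_ac)
qed

text \<open>The character sees only the superdiagonal, which is additive under multiplication of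
  unipotent matrices.\<close>

lemma psi_mult:
  assumes "u \<in> U_real n" "v \<in> U_real n"
  shows "psi n N (u * v) = psi n N u * psi n N v"
proof -
  have "(\<Sum>i<n - 1. of_int (N ! i) * (u * v) $$ (i, i + 1)) =
    (\<Sum>i<n - 1. of_int (N ! i) * u $$ (i, i + 1)) + (\<Sum>i<n - 1. of_int (N ! i) * v $$ (i, i + 1))"
    using U_real_mult_superdiag[OF assms]
    by (auto simp: sum.distrib[symmetric] algebra_simps simp del: index_mult_mat intro!: sum.cong)
  thus ?thesis by (simp add: psi_def e_add)
qed

lemma psi_U_int:
  assumes "u \<in> U_int n"
  shows "psi n N u = 1"
  unfolding psi_def using assms
  by (intro e_Ints Ints_sum Ints_mult) (auto simp: U_int_iff)

subsection \<open>Bruhat decomposition\<close>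

text \<open>The diagonal of \<open>c_mat\<close> as a scalar function, for use inside sums over
  indices.\<close>

definition torus_entry :: "nat \<Rightarrow> int list \<Rightarrow> nat \<Rightarrow> real" where
  "torus_entry n D i = of_int ((1 # D @ [1]) ! (n - i)) / of_int ((1 # D @ [1]) ! (n - i - 1))"

text \<open>The cell is parametrised by the pairs of unipotent factors, so that \<open>mu\<close>
  and \<open>mu'\<close> become the two projections.\<close>

definition bruhat :: "nat \<Rightarrow> int list \<Rightarrow> real mat \<times> real mat \<Rightarrow> real mat" where
  "bruhat n D p = fst p * c_mat n D * long_weyl n * snd p"

text \<open>For positive moduli and \<open>n \<ge> 1\<close> the determinant is 1 by
  \<open>det_bruhat\<close>, so integrality alone describes membership in \<open>SL_int\<close>; see
  \<open>bruhat_cell_eq\<close>.\<close>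

definition bruhat_pairs :: "nat \<Rightarrow> int list \<Rightarrow> (real mat \<times> real mat) set" where
  "bruhat_pairs n D = {p \<in> U_real n \<times> U_real n. elements_mat (bruhat n D p) \<subseteq> \<int>}"

definition bruhat_class :: "nat \<Rightarrow> int list \<Rightarrow> real mat \<times> real mat \<Rightarrow> real mat set" where
  "bruhat_class n D p = double_coset n (bruhat n D p)"

definition coset_term :: "nat \<Rightarrow> int list \<Rightarrow> int list \<Rightarrow> int list \<Rightarrow> real mat set \<Rightarrow> complex" where
  "coset_term n M N D x =
     (let g = (SOME g. g \<in> x) in psi n (rev M) (mu n D g) * psi n N (mu' n D g))"

lemma c_mat_carrier: "c_mat n D \<in> carrier_mat n n"
  by (simp add: c_mat_def)

lemma long_weyl_carrier: "long_weyl n \<in> carrier_mat n n"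
  by (simp add: long_weyl_def)

lemma c_mat_weyl_entry:
  assumes "i < n" "j < n"
  shows "(c_mat n D * long_weyl n) $$ (i, j) = (if i + j = n - 1 then torus_entry n D i * (-1) ^ j else 0)"
  using assms unfolding c_mat_def
  by (subst mat_diag_mult_left[OF long_weyl_carrier]) (auto simp: long_weyl_def torus_entry_def)

lemma bruhat_eq:
  assumes "b1 \<in> carrier_mat n n" "b2 \<in> carrier_mat n n"
  shows "bruhat n D (b1, b2) = b1 * (c_mat n D * long_weyl n) * b2"
  using assms c_mat_carrier[of n D] long_weyl_carrier[of n]
  by (simp add: bruhat_def)

lemma bruhat_carrier:
  assumes "b1 \<in> carrier_mat n n" "b2 \<in> carrier_mat n n"
  shows "bruhat n D (b1, b2) \<in> carrier_mat n n"
  using assms c_mat_carrier long_weyl_carrier unfolding bruhat_def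
  by (auto intro!: mult_carrier_mat[of _ n n])

lemma mult_weyl_entry:
  assumes "b \<in> carrier_mat n n" "i < n" "j < n"
  shows "(b * (c_mat n D * long_weyl n)) $$ (i, j) =
    b $$ (i, n - 1 - j) * torus_entry n D (n - 1 - j) * (-1) ^ j"
proof -
  let ?w = "c_mat n D * long_weyl n"
  have w: "?w \<in> carrier_mat n n" using c_mat_carrier[of n D] long_weyl_carrier[of n] by simp
  have "(b * ?w) $$ (i, j) = (\<Sum>l<n. b $$ (i, l) * ?w $$ (l, j))"
    using assms w by (intro mult_entry)
  also have "\<dots> = (\<Sum>l<n. if l = n - 1 - j then b $$ (i, l) * torus_entry n D l * (-1) ^ j else 0)"
    using assms by (intro sum.cong) (auto simp: c_mat_weyl_entry simp del: index_mult_mat)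
  finally show ?thesis using assms by simp
qed

text \<open>The matrix \<open>c w0\<close> is antidiagonal, which leaves a single sum. The index
  \<open>l\<close> is the column of \<open>b1\<close>; its partner in \<open>b2\<close> is the
  reflected row \<open>n - 1 - l\<close>.\<close>

lemma bruhat_entry:
  assumes "b1 \<in> carrier_mat n n" "b2 \<in> carrier_mat n n" "i < n" "j < n"
  shows "bruhat n D (b1, b2) $$ (i, j) =
    (\<Sum>l<n. b1 $$ (i, l) * torus_entry n D l * (-1) ^ (n - 1 - l) * b2 $$ (n - 1 - l, j))"
proof -
  let ?w = "c_mat n D * long_weyl n"
  have w: "b1 * ?w \<in> carrier_mat n n" using assms c_mat_carrier[of n D] long_weyl_carrier[of n] by simp
  have "bruhat n D (b1, b2) $$ (i, j) = (\<Sum>l<n. (b1 * ?w) $$ (i, l) * b2 $$ (l, j))"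
    unfolding bruhat_eq[OF assms(1,2)] using assms w by (intro mult_entry)
  also have "\<dots> = (\<Sum>l<n. b1 $$ (i, n - 1 - l) * torus_entry n D (n - 1 - l) * (-1) ^ l * b2 $$ (l, j))"
    using assms by (intro sum.cong) (auto simp: mult_weyl_entry simp del: index_mult_mat)
  also have "\<dots> = (\<Sum>l<n. b1 $$ (i, l) * torus_entry n D l * (-1) ^ (n - 1 - l) * b2 $$ (n - 1 - l, j))"
    by (rule sum.reindex_bij_witness[where i = "\<lambda>l. n - 1 - l" and j = "\<lambda>l. n - 1 - l"]) auto
  finally show ?thesis .
qed

lemma bruhat_mult:
  assumes "u \<in> carrier_mat n n" "v \<in> carrier_mat n n" "b1 \<in> carrier_mat n n" "b2 \<in> carrier_mat n n"
  shows "bruhat n D (u * b1, b2 * v) = u * bruhat n D (b1, b2) * v"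
proof -
  let ?w = "c_mat n D * long_weyl n"
  have w: "?w \<in> carrier_mat n n" using c_mat_carrier[of n D] long_weyl_carrier[of n] by simp
  have c: "b1 * ?w \<in> carrier_mat n n" "u * (b1 * ?w) \<in> carrier_mat n n"
    using assms w by auto
  have "u * b1 * ?w = u * (b1 * ?w)" using assms w by (intro assoc_mult_mat)
  moreover have "u * (b1 * ?w) * (b2 * v) = u * (b1 * ?w) * b2 * v"
    using assms c by (intro assoc_mult_mat[symmetric])
  moreover have "u * (b1 * ?w) * b2 = u * (b1 * ?w * b2)"
    using assms c by (intro assoc_mult_mat)
  ultimately show ?thesis using assms by (simp add: bruhat_eq)
qed

lemma mult_left_cancel_inverse:
  fixes b :: "'a :: semiring_1 mat"
  assumes "v \<in> carrier_mat n n" "u \<in> carrier_mat n n" "b \<in> carrier_mat n m" "v * u = 1\<^sub>m n"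
  shows "v * (u * b) = b"
  using assms assoc_mult_mat[of v n n u n b m] left_mult_one_mat[of b n m] by simp

lemma mult_right_cancel_inverse:
  fixes b :: "'a :: semiring_1 mat"
  assumes "v \<in> carrier_mat n n" "u \<in> carrier_mat n n" "b \<in> carrier_mat m n" "v * u = 1\<^sub>m n"
  shows "b * v * u = b"
  using assms assoc_mult_mat[of b m n v n u n] right_mult_one_mat[of b m n] by simp

section \<open>Determinants and integral points of the cell\<close>

text \<open>In the expansion along the last row only the entry 1 in column 0 survives. Deleting that
  column shifts the signs, so the minor is the negative of the smaller Weyl element; its factor
  \<open>(-1) ^ n\<close> cancels the cofactor sign.\<close>

lemma det_long_weyl: "det (long_weyl n) = 1"
proof (induction n)
  case (Suc n)
  have "det (long_weyl (Suc n)) = (\<Sum>j<Suc n. long_weyl (Suc n) $$ (n, j) * cofactor (long_weyl (Suc n)) n j)"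
    by (intro laplace_expansion_row long_weyl_carrier) simp
  also have "\<dots> = (\<Sum>j<Suc n. if j = 0 then cofactor (long_weyl (Suc n)) n 0 else 0)"
    by (intro sum.cong) (auto simp: long_weyl_def)
  also have "\<dots> = cofactor (long_weyl (Suc n)) n 0" by simp
  also have "mat_delete (long_weyl (Suc n)) n 0 = (-1) \<cdot>\<^sub>m long_weyl n"
    by (intro eq_matI) (auto simp: mat_delete_def long_weyl_def)
  hence "cofactor (long_weyl (Suc n)) n 0 = (-1) ^ n * ((-1) ^ n * det (long_weyl n))"
    by (simp add: cofactor_def long_weyl_def)
  also have "\<dots> = 1" using Suc.IH by (simp flip: power_add mult.assoc)
  finally show ?case .
qed (simp add: long_weyl_def)

context
  fixes n :: nat and D :: "int list"
  assumes D: "length D = n - 1" "\<forall>d\<in>set D. d > 0"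
begin

lemma modulus_entry_pos: "k \<le> n \<Longrightarrow> (1 # D @ [1]) ! k > (0 :: int)"
  using D by (auto simp: nth_Cons nth_append split: nat.split)

lemma torus_entry_nonzero: "i < n \<Longrightarrow> torus_entry n D i \<noteq> 0"
  using modulus_entry_pos[of "n - i"] modulus_entry_pos[of "n - i - 1"]
  by (simp add: torus_entry_def)

lemma det_c_mat:
  assumes "n \<ge> 1"
  shows "det (c_mat n D) = 1"
proof -
  define d :: "nat \<Rightarrow> real" where "d k = of_int ((1 # D @ [1]) ! k)" for k
  have d: "d k \<noteq> 0" if "k \<le> n" for k using modulus_entry_pos[OF that] by (simp add: d_def)
  \<comment> \<open>The quotients of consecutive moduli telescope, and both end values
    \<open>d 0\<close> and \<open>d n\<close> are 1 by convention.\<close>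
  have tele: "m \<le> n \<Longrightarrow> (\<Prod>i<m. d (Suc i) / d i) = d m / d 0" for m
    using d by (induction m) auto
  have "det (c_mat n D) = (\<Prod>i<n. d (n - i) / d (n - i - 1))"
    unfolding c_mat_def d_def
    by (subst det_upper_triangular) (auto simp: prod_list_diag_prod mat_diag_def lessThan_atLeast0)
  also have "\<dots> = (\<Prod>i<n. d (Suc i) / d i)"
    by (rule prod.reindex_bij_witness[where i = "\<lambda>l. n - 1 - l" and j = "\<lambda>l. n - 1 - l"])
      (auto simp: Suc_diff_Suc)
  also have "\<dots> = 1" using tele[of n] assms D(1) by (simp add: d_def nth_Cons nth_append split: nat.split)
  finally show ?thesis .
qed

lemma det_bruhat:
  assumes "n \<ge> 1" "b1 \<in> U_real n" "b2 \<in> U_real n"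
  shows "det (bruhat n D (b1, b2)) = 1"
proof -
  note c = U_realD(1)[OF assms(2)] U_realD(1)[OF assms(3)] c_mat_carrier[of n D] long_weyl_carrier[of n]
  have c': "b1 * c_mat n D \<in> carrier_mat n n" "b1 * c_mat n D * long_weyl n \<in> carrier_mat n n"
    using c by auto
  show ?thesis
    unfolding bruhat_def fst_conv snd_conv det_mult[OF c'(2) c(2)] det_mult[OF c'(1) c(4)]
      det_mult[OF c(1,3)]
    using assms by (simp add: det_U_real det_c_mat det_long_weyl)
qed

lemma bruhat_cell_eq:
  assumes "n \<ge> 1"
  shows "bruhat_cell n D = bruhat n D ` bruhat_pairs n D"
proof (intro equalityI subsetI)
  fix g assume "g \<in> bruhat_cell n D"
  then obtain b1 b2 where "b1 \<in> U_real n" "b2 \<in> U_real n" "g = bruhat n D (b1, b2)" "elements_mat g \<subseteq> \<int>"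
    by (auto simp: bruhat_cell_def SL_int_def bruhat_def)
  thus "g \<in> bruhat n D ` bruhat_pairs n D"
    by (intro image_eqI[of _ _ "(b1, b2)"]) (simp_all add: bruhat_pairs_def)
next
  fix g assume "g \<in> bruhat n D ` bruhat_pairs n D"
  then obtain b1 b2 where b: "b1 \<in> U_real n" "b2 \<in> U_real n" "g = bruhat n D (b1, b2)" "elements_mat g \<subseteq> \<int>"
    by (auto simp: bruhat_pairs_def)
  hence "g \<in> SL_int n"
    using det_bruhat[OF assms b(1,2)] bruhat_carrier[OF U_realD(1)[OF b(1)] U_realD(1)[OF b(2)]]
    by (simp add: SL_int_def)
  thus "g \<in> bruhat_cell n D"
    using b by (auto simp: bruhat_cell_def bruhat_def)
qed

section \<open>Uniqueness of the Bruhat decomposition\<close>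

text \<open>Moving the factors across gives \<open>u * (c w0) = (c w0) * v\<close> with
  \<open>u\<close> and \<open>v\<close> unipotent. Conjugation by the antidiagonal
  \<open>c w0\<close> turns upper triangular matrices into lower triangular ones, so
  \<open>u\<close> and \<open>v\<close> are the identity.\<close>

lemma bruhat_inj:
  assumes b: "b1 \<in> U_real n" "b2 \<in> U_real n" and b': "b1' \<in> U_real n" "b2' \<in> U_real n"
    and eq: "bruhat n D (b1, b2) = bruhat n D (b1', b2')"
  shows "b1 = b1'" "b2 = b2'"
proof -
  let ?w = "c_mat n D * long_weyl n"
  obtain i1 where i1: "i1 \<in> U_real n" "b1' * i1 = 1\<^sub>m n" "i1 * b1' = 1\<^sub>m n"
    using U_real_inverse[OF b'(1)] by blast
  obtain i2 where i2: "i2 \<in> U_real n" "b2 * i2 = 1\<^sub>m n" "i2 * b2 = 1\<^sub>m n"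
    using U_real_inverse[OF b(2)] by blast
  note c = U_realD(1)[OF b(1)] U_realD(1)[OF b(2)] U_realD(1)[OF b'(1)] U_realD(1)[OF b'(2)]
    U_realD(1)[OF i1(1)] U_realD(1)[OF i2(1)]
  have w: "?w \<in> carrier_mat n n" using c_mat_carrier[of n D] long_weyl_carrier[of n] by simp
  define u where "u = i1 * b1"
  define v where "v = b2' * i2"
  have u: "u \<in> U_real n" and v: "v \<in> U_real n"
    unfolding u_def v_def using i1 i2 b b' by (auto intro: U_real_mult)
  have "bruhat n D (i1 * b1, b2 * i2) = bruhat n D (i1 * b1', b2' * i2)"
    using c by (simp add: bruhat_mult eq)
  hence "bruhat n D (u, 1\<^sub>m n) = bruhat n D (1\<^sub>m n, v)"
    using i1 i2 by (simp add: u_def v_def)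
  hence uv: "u * ?w = ?w * v"
    using U_realD(1)[OF u] U_realD(1)[OF v] left_mult_one_mat[OF w]
      right_mult_one_mat[of "u * ?w" n n] w by (simp add: bruhat_eq)
  have ent: "u $$ (i, n - 1 - j) * torus_entry n D (n - 1 - j) * (-1) ^ j =
      torus_entry n D i * (-1) ^ (n - 1 - i) * v $$ (n - 1 - i, j)" if ij: "i < n" "j < n" for i j
  proof -
    have "(?w * v) $$ (i, j) = (\<Sum>l<n. ?w $$ (i, l) * v $$ (l, j))"
      using ij w U_realD(1)[OF v] by (intro mult_entry)
    also have "\<dots> = (\<Sum>l<n. if l = n - 1 - i then torus_entry n D i * (-1) ^ l * v $$ (l, j) else 0)"
      using ij by (intro sum.cong) (auto simp: c_mat_weyl_entry simp del: index_mult_mat)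
    finally show ?thesis
      using uv ij mult_weyl_entry[OF U_realD(1)[OF u] ij, of D] by simp
  qed
  \<comment> \<open>Reflecting both indices carries a position above the diagonal to one below it,
    where \<open>v\<close> vanishes.\<close>
  have u0: "u $$ (i, j) = 0" if "i < j" "j < n" for i j
  proof -
    have "v $$ (n - 1 - i, n - 1 - j) = 0" using that U_realD(5)[OF v] by simp
    with ent[of i "n - 1 - j"] that torus_entry_nonzero[of j] show ?thesis by simp
  qed
  have v0: "v $$ (i, j) = 0" if "i < j" "j < n" for i j
  proof -
    have "u $$ (n - 1 - i, n - 1 - j) = 0" using that U_realD(5)[OF u] by simp
    with ent[of "n - 1 - i" j] that torus_entry_nonzero[of "n - 1 - i"] show ?thesis by simp
  qed
  have one: "u = 1\<^sub>m n" "v = 1\<^sub>m n"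
    using U_realD[OF u] U_realD[OF v] u0 v0 by (auto intro!: eq_matI simp: neq_iff)
  have "b1' * u = b1" "v * b2 = b2'"
    unfolding u_def v_def using c i1 i2
    by (auto intro: mult_left_cancel_inverse mult_right_cancel_inverse)
  thus "b1 = b1'" "b2 = b2'" using c by (simp_all add: one)
qed

lemma mu_bruhat:
  assumes "b1 \<in> U_real n" "b2 \<in> U_real n"
  shows "mu n D (bruhat n D (b1, b2)) = b1" "mu' n D (bruhat n D (b1, b2)) = b2"
  using assms bruhat_inj[OF assms]
  by (auto simp: mu_def mu'_def bruhat_def intro!: the_equality)

section \<open>Double cosets in terms of pairs\<close>

lemma double_coset_self:
  assumes "g \<in> carrier_mat n n"
  shows "g \<in> double_coset n g"
  unfolding double_coset_def using U_int_one[of n] assms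
  by (intro CollectI exI[of _ "1\<^sub>m n"]) auto

lemma double_coset_absorb:
  assumes "g \<in> carrier_mat n n" "u \<in> U_int n" "v \<in> U_int n"
  shows "double_coset n (u * g * v) = double_coset n g"
proof -
  \<comment> \<open>Stated for arbitrary \<open>g\<close>, \<open>u\<close>, \<open>v\<close>, so
    that the reverse inclusion follows by applying it to the inverses.\<close>
  have sub: "double_coset n (u * g * v) \<subseteq> double_coset n g"
    if "g \<in> carrier_mat n n" "u \<in> U_int n" "v \<in> U_int n" for g u v
  proof
    fix h assume "h \<in> double_coset n (u * g * v)"
    then obtain u' v' where *: "u' \<in> U_int n" "v' \<in> U_int n" "h = u' * (u * g * v) * v'"
      by (auto simp: double_coset_def)
    note c = that(1) U_realD(1)[OF U_int_subset[OF that(2)]] U_realD(1)[OF U_int_subset[OF that(3)]]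
      U_realD(1)[OF U_int_subset[OF *(1)]] U_realD(1)[OF U_int_subset[OF *(2)]]
    have "u' * (u * g * v) = u' * (u * g) * v"
      using c by (intro assoc_mult_mat[symmetric]) auto
    moreover have "u' * (u * g) = u' * u * g"
      using c by (intro assoc_mult_mat[symmetric]) auto
    moreover have "u' * u * g * v * v' = u' * u * g * (v * v')"
      using c by (intro assoc_mult_mat) auto
    ultimately have "h = (u' * u) * g * (v * v')" using *(3) by simp
    thus "h \<in> double_coset n g"
      unfolding double_coset_def using U_int_mult[OF *(1) that(2)] U_int_mult[OF that(3) *(2)] by blast
  qed
  obtain ui where ui: "ui \<in> U_int n" "u * ui = 1\<^sub>m n" "ui * u = 1\<^sub>m n"
    using U_int_inverse[OF assms(2)] by blast
  obtain vi where vi: "vi \<in> U_int n" "v * vi = 1\<^sub>m n" "vi * v = 1\<^sub>m n"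
    using U_int_inverse[OF assms(3)] by blast
  note c = assms(1) U_realD(1)[OF U_int_subset[OF assms(2)]] U_realD(1)[OF U_int_subset[OF assms(3)]]
    U_realD(1)[OF U_int_subset[OF ui(1)]] U_realD(1)[OF U_int_subset[OF vi(1)]]
  have "ui * (u * g * v) = ui * (u * g) * v"
    using c by (intro assoc_mult_mat[symmetric]) auto
  also have "ui * (u * g) = g"
    using c ui by (intro mult_left_cancel_inverse) auto
  finally have "ui * (u * g * v) * vi = g * v * vi" by simp
  also have "\<dots> = g" using c vi by (intro mult_right_cancel_inverse) auto
  finally have "g = ui * (u * g * v) * vi" ..
  hence "double_coset n g \<subseteq> double_coset n (u * g * v)"
    using sub[of "u * g * v" ui vi] c ui(1) vi(1) by simp
  with sub[OF assms] show ?thesis by blast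
qed

text \<open>The left factor modulo integral unipotents determines the double coset: once the left
  factors match, the real matrix relating the right factors is a quotient of two integral matrices
  of determinant 1, hence integral.\<close>

lemma bruhat_class_eq_iff:
  assumes "n \<ge> 1" "(b1, b2) \<in> bruhat_pairs n D" "(b1', b2') \<in> bruhat_pairs n D"
  shows "bruhat_class n D (b1, b2) = bruhat_class n D (b1', b2') \<longleftrightarrow> (\<exists>u\<in>U_int n. b1' = u * b1)"
proof
  have U: "b1 \<in> U_real n" "b2 \<in> U_real n" "b1' \<in> U_real n" "b2' \<in> U_real n"
    using assms by (auto simp: bruhat_pairs_def)
  note c = U_realD(1)[OF U(1)] U_realD(1)[OF U(2)] U_realD(1)[OF U(3)] U_realD(1)[OF U(4)]
  {
    assume "bruhat_class n D (b1, b2) = bruhat_class n D (b1', b2')"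
    hence "bruhat n D (b1', b2') \<in> double_coset n (bruhat n D (b1, b2))"
      using double_coset_self bruhat_carrier c by (simp add: bruhat_class_def)
    then obtain u v where uv: "u \<in> U_int n" "v \<in> U_int n"
      "bruhat n D (b1', b2') = u * bruhat n D (b1, b2) * v"
      by (auto simp: double_coset_def)
    hence "bruhat n D (b1', b2') = bruhat n D (u * b1, b2 * v)"
      using c U_realD(1)[OF U_int_subset] by (simp add: bruhat_mult)
    hence "b1' = u * b1"
      by (rule bruhat_inj(1)[OF U(3,4) U_real_mult[OF U_int_subset[OF uv(1)] U(1)]
            U_real_mult[OF U(2) U_int_subset[OF uv(2)]]])
    thus "\<exists>u\<in>U_int n. b1' = u * b1" using uv by blast
  }
  {
    assume "\<exists>u\<in>U_int n. b1' = u * b1"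
    then obtain u where u: "u \<in> U_int n" "b1' = u * b1" by blast
    note uc = U_realD(1)[OF U_int_subset[OF u(1)]]
    obtain i2 where i2: "i2 \<in> U_real n" "b2 * i2 = 1\<^sub>m n" "i2 * b2 = 1\<^sub>m n"
      using U_real_inverse[OF U(2)] by blast
    \<comment> \<open>The only candidate, being forced by \<open>b2 * v = b2'\<close>.\<close>
    define v where "v = i2 * b2'"
    have vU: "v \<in> U_real n" using i2 U by (auto simp: v_def intro: U_real_mult)
    note vc = U_realD(1)[OF vU]
    have b2v: "b2 * v = b2'"
      unfolding v_def using c i2 U_realD(1)[OF i2(1)] by (intro mult_left_cancel_inverse) auto
    let ?h = "u * bruhat n D (b1, b2)"
    have bc: "bruhat n D (b1, b2) \<in> carrier_mat n n" using c by (simp add: bruhat_carrier)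
    have eq: "bruhat n D (b1', b2') = ?h * v"
      using c uc vc by (simp add: u(2) b2v[symmetric] bruhat_mult)
    have "elements_mat v \<subseteq> \<int>"
    proof (rule Ints_right_factor)
      show "?h \<in> carrier_mat n n" using uc bc by simp
      show "elements_mat ?h \<subseteq> \<int>"
        using assms(2) u(1) uc bc by (intro Ints_mult_mat) (auto simp: bruhat_pairs_def U_int_def)
      show "det ?h = 1"
        using det_mult[OF uc bc] det_U_real[OF U_int_subset[OF u(1)]] det_bruhat[OF assms(1) U(1,2)] by simp
      show "elements_mat (?h * v) \<subseteq> \<int>"
        using assms(3) eq by (simp add: bruhat_pairs_def)
    qed (rule vc)
    hence "v \<in> U_int n" using vU by (simp add: U_int_def)
    thus "bruhat_class n D (b1, b2) = bruhat_class n D (b1', b2')"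
      using double_coset_absorb[OF bc u(1)] by (simp add: bruhat_class_def eq)
  }
qed

text \<open>The representative picked by \<open>SOME\<close> has factors \<open>u * b1\<close> and
  \<open>b2 * v\<close> with \<open>u\<close>, \<open>v\<close> integral, and the characters are
  trivial on these.\<close>

lemma coset_term_bruhat_class:
  assumes "(b1, b2) \<in> bruhat_pairs n D"
  shows "coset_term n M N D (bruhat_class n D (b1, b2)) = psi n (rev M) b1 * psi n N b2"
proof -
  have U: "b1 \<in> U_real n" "b2 \<in> U_real n" using assms by (auto simp: bruhat_pairs_def)
  note c = U_realD(1)[OF U(1)] U_realD(1)[OF U(2)]
  define g where "g = (SOME g. g \<in> bruhat_class n D (b1, b2))"
  have "g \<in> bruhat_class n D (b1, b2)"
    unfolding g_def bruhat_class_def by (rule someI, rule double_coset_self[OF bruhat_carrier[OF c]])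
  then obtain u v where uv: "u \<in> U_int n" "v \<in> U_int n" "g = u * bruhat n D (b1, b2) * v"
    by (auto simp: bruhat_class_def double_coset_def)
  have uvU: "u \<in> U_real n" "v \<in> U_real n" using uv U_int_subset by auto
  have "g = bruhat n D (u * b1, b2 * v)"
    using c uv U_realD(1)[OF U_int_subset] by (simp add: bruhat_mult)
  hence "mu n D g = u * b1" "mu' n D g = b2 * v"
    using mu_bruhat[OF U_real_mult[OF uvU(1) U(1)] U_real_mult[OF U(2) uvU(2)]] by simp_all
  moreover have "coset_term n M N D (bruhat_class n D (b1, b2)) =
      psi n (rev M) (mu n D g) * psi n N (mu' n D g)"
    by (simp add: coset_term_def g_def Let_def)
  ultimately show ?thesis
    using psi_mult[OF uvU(1) U(1)] psi_mult[OF U(2) uvU(2)] psi_U_int[OF uv(1)] psi_U_int[OF uv(2)]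
    by simp
qed

lemma kloosterman_eq_sum:
  assumes "n \<ge> 1"
  shows "kloosterman n M N D = sum (coset_term n M N D) (bruhat_class n D ` bruhat_pairs n D)"
proof -
  have "X_set n D = bruhat_class n D ` bruhat_pairs n D"
    unfolding X_set_def bruhat_cell_eq[OF assms] image_image bruhat_class_def ..
  thus ?thesis by (simp add: kloosterman_def coset_term_def[abs_def])
qed

lemma bruhat_pairs_translate:
  assumes "(b1, b2) \<in> bruhat_pairs n D" "u \<in> U_int n" "v \<in> U_int n"
  shows "(u * b1, b2 * v) \<in> bruhat_pairs n D"
    "bruhat_class n D (u * b1, b2 * v) = bruhat_class n D (b1, b2)"
proof -
  have U: "b1 \<in> U_real n" "b2 \<in> U_real n" using assms by (auto simp: bruhat_pairs_def)
  note c = U_realD(1)[OF U(1)] U_realD(1)[OF U(2)]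
    U_realD(1)[OF U_int_subset[OF assms(2)]] U_realD(1)[OF U_int_subset[OF assms(3)]]
  have bc: "bruhat n D (b1, b2) \<in> carrier_mat n n" using c by (simp add: bruhat_carrier)
  have eq: "bruhat n D (u * b1, b2 * v) = u * bruhat n D (b1, b2) * v"
    using c by (intro bruhat_mult)
  have "elements_mat (u * bruhat n D (b1, b2) * v) \<subseteq> \<int>"
    using assms c bc by (intro Ints_mult_mat[of _ n n _ n]) (auto simp: bruhat_pairs_def U_int_def)
  thus "(u * b1, b2 * v) \<in> bruhat_pairs n D"
    using assms U U_int_subset by (auto simp: bruhat_pairs_def eq intro: U_real_mult)
  show "bruhat_class n D (u * b1, b2 * v) = bruhat_class n D (b1, b2)"
    using double_coset_absorb[OF bc assms(2,3)] by (simp add: bruhat_class_def eq)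
qed

end

section \<open>Integer elimination, and the outer row and column of a cell element\<close>

text \<open>Used to clear entries: with a pivot \<open>a\<close> coprime to the modulus
  \<open>m\<close>, the numbers \<open>p i\<close> and \<open>q i\<close> say which multiples of two
  rows or columns to add in order to kill \<open>b i\<close>. They come from a Bezout relation
  scaled by \<open>b i\<close>.\<close>

lemma coprime_solve_cong:
  fixes a m :: int and b :: "'i \<Rightarrow> int"
  assumes "coprime a m"
  obtains p q where "\<And>i. b i + p i * a + q i * m = 0"
proof -
  obtain s t where "s * a + t * m = 1"
    using bezout_int[of a m] assms by (auto simp: coprime_iff_gcd_eq_1)
  moreover have "b i + (- b i * s) * a + (- b i * t) * m = b i - b i * (s * a + t * m)" for i
    by (simp add: algebra_simps)
  ultimately show thesis by (intro that[of "\<lambda>i. - b i * s" "\<lambda>i. - b i * t"]) simp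
qed

text \<open>The last row of \<open>b1\<close> is a unit vector, so only the term
  \<open>l = n - 1\<close> survives. The first column is computed in the same way from the first
  column of \<open>b2\<close>.\<close>

lemma bruhat_last_row:
  assumes "b1 \<in> U_real n" "b2 \<in> U_real n" "j < n"
  shows "bruhat n D (b1, b2) $$ (n - 1, j) = torus_entry n D (n - 1) * b2 $$ (0, j)"
proof -
  have "bruhat n D (b1, b2) $$ (n - 1, j) =
      (\<Sum>l<n. b1 $$ (n - 1, l) * torus_entry n D l * (-1) ^ (n - 1 - l) * b2 $$ (n - 1 - l, j))"
    using assms U_realD(1) by (intro bruhat_entry) auto
  also have "\<dots> = (\<Sum>l<n. if l = n - 1 then torus_entry n D (n - 1) * b2 $$ (0, j) else 0)"
    using assms U_realD[OF assms(1)] by (intro sum.cong) auto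
  finally show ?thesis using assms(3) by simp
qed

lemma bruhat_first_col:
  assumes "b1 \<in> U_real n" "b2 \<in> U_real n" "i < n"
  shows "bruhat n D (b1, b2) $$ (i, 0) = b1 $$ (i, n - 1) * torus_entry n D (n - 1)"
proof -
  have "bruhat n D (b1, b2) $$ (i, 0) =
      (\<Sum>l<n. b1 $$ (i, l) * torus_entry n D l * (-1) ^ (n - 1 - l) * b2 $$ (n - 1 - l, 0))"
    using assms U_realD(1) by (intro bruhat_entry) auto
  also have "\<dots> = (\<Sum>l<n. if l = n - 1 then b1 $$ (i, n - 1) * torus_entry n D (n - 1) else 0)"
    using assms U_realD[OF assms(2)] by (intro sum.cong) auto
  finally show ?thesis using assms(3) by simp
qed

subsection \<open>The cell of \<open>SL\<^sub>2\<close>\<close>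

definition shear :: "real \<Rightarrow> real mat" where
  "shear s = Matrix.mat 2 2 (\<lambda>(i, j). if i = j then 1 else if i < j then s else 0)"

lemma shear_U_real: "shear s \<in> U_real 2"
  by (rule U_realI) (auto simp: shear_def)

lemma shear_entry: "shear s $$ (0, Suc 0) = s"
  by (simp add: shear_def)

text \<open>With superdiagonal entries \<open>s\<close> and \<open>t\<close> the matrix has rows
  \<open>(s d, s t d - 1 / d)\<close> and \<open>(d, t d)\<close>. For nonzero \<open>d\<close>,
  \<open>x = s d\<close> and \<open>y = t d\<close>, the last condition is
  \<open>x y \<equiv> 1\<close> modulo \<open>d\<close>, as in the classical Kloosterman
  sum.\<close>

lemma bruhat_pairs_2:
  "(a1, a2) \<in> bruhat_pairs 2 [d] \<longleftrightarrow> a1 \<in> U_real 2 \<and> a2 \<in> U_real 2 \<and>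
    a1 $$ (0, 1) * d \<in> \<int> \<and> a2 $$ (0, 1) * d \<in> \<int> \<and>
    a1 $$ (0, 1) * a2 $$ (0, 1) * d - 1 / d \<in> \<int>"
proof (cases "a1 \<in> U_real 2 \<and> a2 \<in> U_real 2")
  case True
  note u = U_realD[of a1 2] U_realD[of a2 2]
  have b: "bruhat 2 [d] (a1, a2) \<in> carrier_mat 2 2" using True u by (intro bruhat_carrier) auto
  have te: "torus_entry 2 [d] 0 = 1 / d" "torus_entry 2 [d] (Suc 0) = d"
    by (simp_all add: torus_entry_def numeral_2_eq_2)
  have ent: "bruhat 2 [d] (a1, a2) $$ (i, j) =
      a1 $$ (i, 1) * d * a2 $$ (0, j) - a1 $$ (i, 0) / d * a2 $$ (1, j)" if "i < 2" "j < 2" for i j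
  proof -
    have "{..<2::nat} = {0, Suc 0}" by auto
    thus ?thesis using that True u by (simp add: bruhat_entry te)
  qed
  have "(\<forall>i<2. \<forall>j<2. bruhat 2 [d] (a1, a2) $$ (i, j) \<in> \<int>) \<longleftrightarrow>
    bruhat 2 [d] (a1, a2) $$ (0, 0) \<in> \<int> \<and> bruhat 2 [d] (a1, a2) $$ (0, 1) \<in> \<int> \<and>
    bruhat 2 [d] (a1, a2) $$ (1, 0) \<in> \<int> \<and> bruhat 2 [d] (a1, a2) $$ (1, 1) \<in> \<int>"
    by (auto simp: less_2_cases_iff)
  thus ?thesis
    using True u by (auto simp: bruhat_pairs_def elements_mat_subset_iff[OF b] ent mult_ac)
qed (auto simp: bruhat_pairs_def)

lemma U_real_2_eq_shear:
  assumes "a \<in> U_real 2"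
  shows "a = shear (a $$ (0, 1))"
  using U_realD[OF assms] by (intro eq_matI) (auto simp: shear_def less_2_cases_iff)

lemma shear_mult: "shear s * shear t = shear (s + t)"
  by (intro eq_matI) (auto simp: shear_def scalar_prod_def less_2_cases_iff numeral_2_eq_2)

lemma shear_U_int_iff: "shear s \<in> U_int 2 \<longleftrightarrow> s \<in> \<int>"
  using shear_U_real[of s] by (auto simp: U_int_iff shear_def less_2_cases_iff)

lemma U_int_2_translate_iff:
  assumes "a \<in> U_real 2" "a' \<in> U_real 2"
  shows "(\<exists>u\<in>U_int 2. a' = u * a) \<longleftrightarrow> a' $$ (0, 1) - a $$ (0, 1) \<in> \<int>"
proof
  assume "\<exists>u\<in>U_int 2. a' = u * a"
  then obtain u where u: "u \<in> U_int 2" "a' = u * a" by blast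
  hence "u = shear (u $$ (0, 1))" by (intro U_real_2_eq_shear U_int_subset)
  moreover have "u $$ (0, 1) \<in> \<int>" using u(1) by (auto simp: U_int_iff)
  moreover have "a' $$ (0, 1) = u $$ (0, 1) + a $$ (0, 1)"
    using U_real_mult_superdiag[OF U_int_subset[OF u(1)] assms(1), of 0] u(2) by simp
  ultimately show "a' $$ (0, 1) - a $$ (0, 1) \<in> \<int>" by simp
next
  assume *: "a' $$ (0, 1) - a $$ (0, 1) \<in> \<int>"
  have "a' = shear (a' $$ (0, 1) - a $$ (0, 1)) * a"
    using U_real_2_eq_shear[OF assms(1)] U_real_2_eq_shear[OF assms(2)] shear_mult
    by (metis diff_add_cancel)
  thus "\<exists>u\<in>U_int 2. a' = u * a" using * shear_U_int_iff by blast
qed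

subsection \<open>Unipotent matrices of consecutive sizes\<close>

definition twist :: "nat \<Rightarrow> real \<Rightarrow> nat \<Rightarrow> real" where
  "twist k r i = (if i = k - 1 then r else 1)"

text \<open>In block form, with \<open>T\<close> the diagonal matrix with entries \<open>twist k r\<close> and \<open>e\<close> the last (first) standard
  basis vector, \<open>extend_left k r s b\<close> is \<open>[[T\<^sup>-\<^sup>1 b T, s e], [0, 1]]\<close> and \<open>extend_right k t b\<close> is
  \<open>[[1, t e\<^sup>T], [0, b]]\<close>.\<close>

definition extend_left :: "nat \<Rightarrow> real \<Rightarrow> real \<Rightarrow> real mat \<Rightarrow> real mat" where
  "extend_left k r s b = Matrix.mat (Suc k) (Suc k) (\<lambda>(i, j).
     if i < k \<and> j < k then twist k r j * b $$ (i, j) / twist k r i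
     else if i = j then 1 else if i = k - 1 \<and> j = k then s else 0)"

definition extend_right :: "nat \<Rightarrow> real \<Rightarrow> real mat \<Rightarrow> real mat" where
  "extend_right k t b = Matrix.mat (Suc k) (Suc k) (\<lambda>(i, j).
     if 0 < i \<and> 0 < j then b $$ (i - 1, j - 1)
     else if i = j then 1 else if i = 0 \<and> j = 1 then t else 0)"

lemma extend_left_U_real:
  assumes "b \<in> U_real k" "r \<noteq> 0"
  shows "extend_left k r s b \<in> U_real (Suc k)"
  using U_realD[OF assms(1)] assms(2)
  by (intro U_realI) (auto simp: extend_left_def twist_def)

lemma extend_right_U_real:
  assumes "b \<in> U_real k"
  shows "extend_right k t b \<in> U_real (Suc k)"
  using U_realD[OF assms] by (intro U_realI) (auto simp: extend_right_def)

lemma extend_right_of_U_real: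
  assumes "B \<in> U_real (Suc k)" "\<And>j. 2 \<le> j \<Longrightarrow> j \<le> k \<Longrightarrow> B $$ (0, j) = 0"
  obtains b where "b \<in> U_real k" "B = extend_right k (B $$ (0, 1)) b"
proof
  define b where "b = Matrix.mat k k (\<lambda>(i, j). B $$ (Suc i, Suc j))"
  note B = U_realD[OF assms(1)]
  show "b \<in> U_real k" using B by (intro U_realI) (auto simp: b_def)
  show "B = extend_right k (B $$ (0, 1)) b"
  proof (rule eq_matI)
    fix i j assume "i < dim_row (extend_right k (B $$ (0, 1)) b)" "j < dim_col (extend_right k (B $$ (0, 1)) b)"
    hence "i \<le> k" "j \<le> k" by (auto simp: extend_right_def)
    moreover consider "i > 0" "j > 0" | "i > 0" "j = 0" | "i = 0" "j = 0" | "i = 0" "j = 1" | "i = 0" "j \<ge> 2"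
      by linarith
    ultimately show "B $$ (i, j) = extend_right k (B $$ (0, 1)) b $$ (i, j)"
      using B assms(2) by cases (auto simp: extend_right_def b_def)
  qed (use B in \<open>auto simp: extend_right_def\<close>)
qed

text \<open>Conjugating the upper left block back by the twist recovers \<open>b\<close>.\<close>

lemma extend_left_of_U_real:
  assumes "B \<in> U_real (Suc k)" "\<And>i. i < k - 1 \<Longrightarrow> B $$ (i, k) = 0" "r \<noteq> 0" "k \<ge> 1"
  obtains b where "b \<in> U_real k" "B = extend_left k r (B $$ (k - 1, k)) b"
proof
  define b where "b = Matrix.mat k k (\<lambda>(i, j). twist k r i * B $$ (i, j) / twist k r j)"
  have tw: "twist k r i \<noteq> 0" for i using assms(3) by (simp add: twist_def)
  note B = U_realD[OF assms(1)]
  show "b \<in> U_real k" using B tw by (intro U_realI) (auto simp: b_def)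
  show "B = extend_left k r (B $$ (k - 1, k)) b" (is "_ = ?E")
  proof (rule eq_matI)
    fix i j assume "i < dim_row ?E" "j < dim_col ?E"
    hence "i \<le> k" "j \<le> k" by (auto simp: extend_left_def)
    moreover have "i < k - 1 \<or> i = k - 1 \<or> i = k" using \<open>i \<le> k\<close> by linarith
    ultimately show "B $$ (i, j) = ?E $$ (i, j)"
      using B assms(2,4) tw by (cases "j = k") (auto simp: extend_left_def b_def)
  qed (use B in \<open>auto simp: extend_left_def\<close>)
qed

text \<open>Equivalence of extended matrices splits into equivalence of the two data. Going down,
  the zeros in the last column force \<open>r\<close> to divide column \<open>k - 1\<close> of
  \<open>u\<close> above the diagonal, so the block of \<open>u\<close> remains integral after
  undoing the twist. Going up, the twisted block is integral at once and the last column is chosen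
  to restore the zeros.\<close>

lemma extend_left_translate:
  assumes b: "b \<in> U_real k" "b' \<in> U_real k" and k: "k \<ge> 1"
    and r: "r > 0" "s * of_int r \<in> \<int>" "\<And>x. s * of_int r = of_int x \<Longrightarrow> coprime x r"
  shows "(\<exists>u\<in>U_int (Suc k). extend_left k (of_int r) s' b' = u * extend_left k (of_int r) s b) \<longleftrightarrow>
    s' - s \<in> \<int> \<and> (\<exists>u\<in>U_int k. b' = u * b)"
    (is "(\<exists>u\<in>_. ?E' = u * ?E) \<longleftrightarrow> _")
proof
  define tw where "tw = twist k (of_int r)"
  have tw: "tw i \<noteq> 0" for i using r(1) by (simp add: tw_def twist_def)
  have E: "?E \<in> U_real (Suc k)" "?E' \<in> U_real (Suc k)" using b r(1) by (auto intro: extend_left_U_real)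
  note bc = U_realD(1)[OF b(1)]
  have E_block: "?E $$ (i, j) = tw j * b $$ (i, j) / tw i" "?E' $$ (i, j) = tw j * b' $$ (i, j) / tw i"
    if "i < k" "j < k" for i j using that by (simp_all add: extend_left_def tw_def)
  have E_last: "?E $$ (i, k) = (if i = k - 1 then s else 0)" "?E' $$ (i, k) = (if i = k - 1 then s' else 0)"
    if "i < k" for i using that by (simp_all add: extend_left_def)
  have E_row: "?E $$ (k, j) = (if j = k then 1 else 0)" "?E' $$ (k, j) = (if j = k then 1 else 0)"
    if "j \<le> k" for j using that by (simp_all add: extend_left_def)
  have uE: "(u * ?E) $$ (i, j) = (\<Sum>l<k. u $$ (i, l) * (tw j * b $$ (l, j) / tw l))"
    if "u \<in> U_real (Suc k)" "i \<le> k" "j < k" for u i j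
  proof -
    have "(u * ?E) $$ (i, j) = (\<Sum>l<Suc k. u $$ (i, l) * ?E $$ (l, j))"
      using U_realD(1)[OF that(1)] U_realD(1)[OF E(1)] that
      by (intro mult_entry[of _ "Suc k" "Suc k" _ "Suc k"]) auto
    thus ?thesis using that by (simp add: E_row E_block)
  qed
  have uE_last: "(u * ?E) $$ (i, k) = u $$ (i, k - 1) * s + u $$ (i, k)"
    if "u \<in> U_real (Suc k)" "i \<le> k" for u i
  proof -
    have "(u * ?E) $$ (i, k) = (\<Sum>l<Suc k. u $$ (i, l) * ?E $$ (l, k))"
      using U_realD(1)[OF that(1)] U_realD(1)[OF E(1)] that
      by (intro mult_entry[of _ "Suc k" "Suc k" _ "Suc k"]) auto
    also have "\<dots> = (\<Sum>l<k. u $$ (i, l) * ?E $$ (l, k)) + u $$ (i, k)"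
      by (simp add: E_row)
    also have "(\<Sum>l<k. u $$ (i, l) * ?E $$ (l, k)) = (\<Sum>l<k. if l = k - 1 then u $$ (i, l) * s else 0)"
      by (intro sum.cong) (auto simp: E_last)
    finally show ?thesis using k by simp
  qed
  {
    assume "\<exists>u\<in>U_int (Suc k). ?E' = u * ?E"
    then obtain u where u: "u \<in> U_int (Suc k)" and eq: "?E' = u * ?E" by blast
    note uU = U_int_subset[OF u]
    have uZ: "u $$ (i, j) \<in> \<int>" if "i \<le> k" "j \<le> k" for i j using u that by (auto simp: U_int_iff)
    \<comment> \<open>The upper left block of \<open>u\<close>, conjugated back by the twist; only
      its column \<open>k - 1\<close> acquires a denominator \<open>r\<close>.\<close>
    define u' where "u' = Matrix.mat k k (\<lambda>(i, j). tw i * u $$ (i, j) / tw j)"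
    have u'U: "u' \<in> U_real k"
      using U_realD[OF uU] tw by (intro U_realI) (auto simp: u'_def)
    have "s' = s + u $$ (k - 1, k)"
      using uE_last[OF uU, of "k - 1"] E_last(2)[of "k - 1"] U_realD(4)[OF uU, of "k - 1"] k eq by simp
    hence s: "s' - s \<in> \<int>" using uZ by simp
    \<comment> \<open>Row \<open>i\<close> of the last column reads \<open>m * s + m' = 0\<close>.
      Multiplied by \<open>r\<close> it becomes \<open>m * x + m' * r = 0\<close> with
      \<open>x\<close> coprime to \<open>r\<close>.\<close>
    have div: "u $$ (i, k - 1) / of_int r \<in> \<int>" if "i < k - 1" for i
    proof -
      have "u $$ (i, k - 1) \<in> \<int>" "u $$ (i, k) \<in> \<int>" using that by (auto intro!: uZ)
      then obtain m m' where m: "u $$ (i, k - 1) = of_int m" "u $$ (i, k) = of_int m'"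
        by (auto elim!: Ints_cases)
      obtain x where x: "s * of_int r = of_int x" using r(2) by (auto elim: Ints_cases)
      have h0: "of_int m * s + of_int m' = 0"
        using uE_last[OF uU, of i] E_last(2)[of i] that unfolding eq m by simp
      have "real_of_int (m * x + m' * r) = of_int m * (s * of_int r) + of_int m' * of_int r"
        by (simp add: x)
      also have "\<dots> = (of_int m * s + of_int m') * of_int r"
        by (simp only: distrib_right mult.assoc)
      also have "\<dots> = 0" unfolding h0 by simp
      finally have "real_of_int (m * x + m' * r) = 0" .
      hence "m * x + m' * r = 0" unfolding of_int_eq_0_iff .
      hence "r dvd m * x" by (metis dvd_add_times_triv_right_iff dvd_0_right mult.commute)
      hence "r dvd m" using r(3)[OF x] by (simp add: coprime_commute coprime_dvd_mult_left_iff)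
      then obtain c where "m = r * c" by blast
      thus ?thesis using r(1) m by simp
    qed
    have "u' $$ (i, j) \<in> \<int>" if "i < k" "j < k" for i j
    proof -
      consider "i < k - 1" "j = k - 1" | "i = k - 1" "j < k - 1" | "i = k - 1" "j = k - 1" | "i < k - 1" "j < k - 1"
        using \<open>i < k\<close> \<open>j < k\<close> by linarith
      thus ?thesis
      proof cases
        case 1
        thus ?thesis using div[of i] by (simp add: u'_def tw_def twist_def)
      next
        case 2
        thus ?thesis using U_realD(5)[OF u'U, of j i] that by simp
      next
        case 3
        thus ?thesis using U_realD(4)[OF u'U, of i] that by simp
      next
        case 4
        thus ?thesis using uZ[of i j] by (simp add: u'_def tw_def twist_def)
      qed
    qed
    hence u': "u' \<in> U_int k" using u'U by (simp add: U_int_iff)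
    have "b' = u' * b"
    proof (rule eq_matI)
      fix i j assume "i < dim_row (u' * b)" "j < dim_col (u' * b)"
      hence ij: "i < k" "j < k" using bc by (auto simp: u'_def)
      have "tw j * b' $$ (i, j) / tw i = (\<Sum>l<k. u $$ (i, l) * (tw j * b $$ (l, j) / tw l))"
        using uE[OF uU, of i j] E_block(2)[of i j] ij eq by simp
      hence "b' $$ (i, j) = tw i / tw j * (\<Sum>l<k. u $$ (i, l) * (tw j * b $$ (l, j) / tw l))"
        using tw[of i] tw[of j] by (simp add: field_simps)
      also have "\<dots> = (\<Sum>l<k. u' $$ (i, l) * b $$ (l, j))"
        using ij tw by (auto simp: u'_def sum_distrib_left intro!: sum.cong)
      also have "\<dots> = (u' * b) $$ (i, j)"
        using U_realD(1)[OF u'U] bc ij by (intro mult_entry[symmetric])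
      finally show "b' $$ (i, j) = (u' * b) $$ (i, j)" .
    qed (use U_realD[OF b(2)] bc in \<open>auto simp: u'_def\<close>)
    thus "s' - s \<in> \<int> \<and> (\<exists>u\<in>U_int k. b' = u * b)" using s u' by blast
  }
  {
    assume "s' - s \<in> \<int> \<and> (\<exists>u\<in>U_int k. b' = u * b)"
    then obtain w where s: "s' - s \<in> \<int>" and w: "w \<in> U_int k" "b' = w * b" by blast
    note wU = U_int_subset[OF w(1)]
    have wZ: "w $$ (i, j) \<in> \<int>" if "i < k" "j < k" for i j using w that by (auto simp: U_int_iff)
    \<comment> \<open>The last column compensates the contribution
      \<open>r * w $$ (i, k - 1) * s\<close> that the twisted block produces in rows above
      \<open>k - 1\<close>; it is integral because \<open>s * r\<close> is.\<close>
    define u where "u = Matrix.mat (Suc k) (Suc k) (\<lambda>(i, j).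
      if i < k \<and> j < k then tw j * w $$ (i, j) / tw i
      else if i = j then 1 else if j < k then 0
      else if i = k - 1 then s' - s else - (of_int r * w $$ (i, k - 1) * s))"
    have uU: "u \<in> U_real (Suc k)"
      using U_realD[OF wU] tw by (intro U_realI) (auto simp: u_def)
    have "u $$ (i, j) \<in> \<int>" if "i \<le> k" "j \<le> k" for i j
    proof -
      have "i = k \<or> i = k - 1 \<or> i < k - 1" using that by linarith
      moreover have "j = k \<or> j < k \<and> (j = k - 1 \<or> j < k - 1)" using that by linarith
      ultimately consider "i < k - 1" "j < k" | "i = k - 1" "j < k - 1" | "i = k - 1" "j = k - 1"
        | "j = k" "i = k - 1" | "j = k" "i < k - 1" | "i = k" "j = k" | "i = k" "j < k"
        by blast
      thus ?thesis
      proof cases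
        case 1
        thus ?thesis using wZ[of i j] by (auto simp: u_def tw_def twist_def)
      next
        case 2
        thus ?thesis using U_realD(5)[OF uU, of j i] that by simp
      next
        case 3
        thus ?thesis using U_realD(4)[OF uU, of i] that by simp
      next
        case 4
        thus ?thesis using s k by (simp add: u_def)
      next
        case 5
        have "of_int r * w $$ (i, k - 1) * s = w $$ (i, k - 1) * (s * of_int r)" by simp
        also have "\<dots> \<in> \<int>" using 5 by (intro Ints_mult[OF _ r(2)] wZ) auto
        finally show ?thesis using 5 k by (simp add: u_def)
      next
        case 6
        thus ?thesis by (simp add: u_def)
      next
        case 7
        thus ?thesis by (simp add: u_def)
      qed
    qed
    hence u: "u \<in> U_int (Suc k)" using uU by (simp add: U_int_iff)
    have "?E' = u * ?E"
    proof (rule eq_matI)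
      fix i j assume "i < dim_row (u * ?E)" "j < dim_col (u * ?E)"
      hence ij: "i \<le> k" "j \<le> k" by (auto simp: u_def extend_left_def)
      consider "i = k" | "i < k" "j = k" | "i < k" "j < k" using ij by linarith
      thus "?E' $$ (i, j) = (u * ?E) $$ (i, j)"
      proof cases
        case 1
        moreover have "{k<..<Suc k} = {}" by auto
        ultimately show ?thesis
          using U_real_mult_entry[OF uU U_realD(1)[OF E(1)], of i j] E_row[of j] ij by simp
      next
        case 2
        thus ?thesis
          using uE_last[OF uU ij(1)] E_last(2)[of i] tw[of i] U_realD(4)[OF wU, of "k - 1"] k
          by (auto simp: u_def tw_def twist_def)
      next
        case 3
        have "(u * ?E) $$ (i, j) = (\<Sum>l<k. tw j / tw i * (w $$ (i, l) * b $$ (l, j)))"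
          unfolding uE[OF uU ij(1) 3(2)] using 3 tw by (auto simp: u_def intro!: sum.cong)
        also have "\<dots> = tw j / tw i * (w * b) $$ (i, j)"
          using mult_entry[OF U_realD(1)[OF wU] bc 3] by (simp add: sum_distrib_left)
        finally show ?thesis using E_block(2)[OF 3] w(2) by simp
      qed
    qed (auto simp: u_def extend_left_def)
    thus "\<exists>u\<in>U_int (Suc k). ?E' = u * ?E" using u by blast
  }
qed

section \<open>Block form of an extended cell element\<close>

lemma torus_entry_last: "n \<ge> 1 \<Longrightarrow> D \<noteq> [] \<Longrightarrow> torus_entry n D (n - 1) = of_int (D ! 0)"
  by (cases D) (auto simp: torus_entry_def)

text \<open>Prepending \<open>r\<close> shifts the moduli, so the torus entries agree except at
  \<open>l = k - 1\<close>. There the denominator is \<open>r\<close> in place of the conventional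
  1, and the twist removes it.\<close>

lemma torus_entry_Cons:
  assumes "l < k" "D \<noteq> []" "r \<noteq> 0"
  shows "twist k (of_int r) l * torus_entry (Suc k) (r # D) l = torus_entry k D l"
proof (cases "l = k - 1")
  case True
  thus ?thesis using assms by (cases D) (auto simp: torus_entry_def twist_def)
next
  case False
  \<comment> \<open>Writing the positions as successors of \<open>m\<close> puts the lookups beyond
    the prepended entries, where both lists coincide.\<close>
  define m where "m = k - l - 2"
  have "k - l = Suc (Suc m)" using False assms(1) by (simp add: m_def)
  moreover from this have "Suc k - l = Suc (Suc (Suc m))" by linarith
  ultimately show ?thesis using False by (simp add: torus_entry_def twist_def)
qed

text \<open>The terms \<open>l < k\<close> reproduce the smaller cell element in the upper right
  block, with last row divided by \<open>r\<close> and a sign from comparing Weyl elements of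
  consecutive sizes. The term \<open>l = k\<close> adds the product of the first column and the
  first row of the right factor.\<close>

lemma bruhat_extend_entry:
  assumes b: "b1 \<in> U_real k" "b2 \<in> U_real k" and D: "D \<noteq> []" "r \<noteq> 0" and ij: "i \<le> k" "j \<le> k"
  shows "bruhat (Suc k) (r # D) (extend_left k (of_int r) s b1, extend_right k t b2) $$ (i, j) =
    (if i < k \<and> 0 < j then - bruhat k D (b1, b2) $$ (i, j - 1) / twist k (of_int r) i else 0) +
    (if i = k then of_int r else if i = k - 1 then s * of_int r else 0) *
    (if j = 0 then 1 else if j = 1 then t else 0)"
proof -
  let ?L = "extend_left k (of_int r) s b1" and ?R = "extend_right k t b2"
  let ?te = "torus_entry (Suc k) (r # D)"
  define tw where "tw = twist k (of_int r)"
  have tw: "tw l \<noteq> 0" for l using D(2) by (simp add: tw_def twist_def)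
  have c: "?L \<in> carrier_mat (Suc k) (Suc k)" "?R \<in> carrier_mat (Suc k) (Suc k)"
    by (simp_all add: extend_left_def extend_right_def)
  have summand: "?L $$ (i, l) * ?te l * (-1) ^ (k - l) * ?R $$ (k - l, j) =
      (if i < k \<and> 0 < j then - (b1 $$ (i, l) * torus_entry k D l * (-1) ^ (k - 1 - l) * b2 $$ (k - 1 - l, j - 1)) / tw i
       else 0)" if l: "l < k" for l
  proof (cases "i < k \<and> 0 < j")
    case True
    have "?L $$ (i, l) = tw l * b1 $$ (i, l) / tw i"
      using True l by (simp add: extend_left_def tw_def)
    moreover have "tw l * ?te l = torus_entry k D l"
      using torus_entry_Cons[OF l D] by (simp add: tw_def)
    moreover have "?R $$ (k - l, j) = b2 $$ (k - 1 - l, j - 1)"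
      using True l ij by (auto simp: extend_right_def intro!: arg_cong[of _ _ "\<lambda>x. b2 $$ (x, _)"])
    moreover have "k - l = Suc (k - 1 - l)" using l by simp
    hence "(-1 :: real) ^ (k - l) = - ((-1) ^ (k - 1 - l))" by (metis power_Suc mult_minus1)
    moreover have "tw l * b1 $$ (i, l) / tw i * ?te l = b1 $$ (i, l) * (tw l * ?te l) / tw i" by simp
    ultimately show ?thesis using True by simp
  next
    case False
    \<comment> \<open>Either \<open>i = k\<close>, where the last row of the left factor is a unit
      vector, or \<open>j = 0\<close>, where the first column of the right factor is one.\<close>
    hence "?L $$ (i, l) = 0 \<or> ?R $$ (k - l, j) = 0"
      using l ij by (auto simp: extend_left_def extend_right_def)
    thus ?thesis using False by auto
  qed
  have te_k: "?te k = of_int r" by (simp add: torus_entry_def)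
  have "bruhat (Suc k) (r # D) (?L, ?R) $$ (i, j) =
      (\<Sum>l<Suc k. ?L $$ (i, l) * ?te l * (-1) ^ (k - l) * ?R $$ (k - l, j))"
    using bruhat_entry[OF c, of i j] ij by simp
  also have "\<dots> = (\<Sum>l<k. ?L $$ (i, l) * ?te l * (-1) ^ (k - l) * ?R $$ (k - l, j)) +
      ?L $$ (i, k) * of_int r * ?R $$ (0, j)" by (simp add: te_k)
  also have "(\<Sum>l<k. ?L $$ (i, l) * ?te l * (-1) ^ (k - l) * ?R $$ (k - l, j)) =
      (\<Sum>l<k. if i < k \<and> 0 < j then - (b1 $$ (i, l) * torus_entry k D l * (-1) ^ (k - 1 - l) * b2 $$ (k - 1 - l, j - 1)) / tw i
       else 0)"
    by (intro sum.cong refl summand) auto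
  also have "\<dots> = (if i < k \<and> 0 < j then - bruhat k D (b1, b2) $$ (i, j - 1) / tw i else 0)"
  proof (cases "i < k \<and> 0 < j")
    case True
    have "bruhat k D (b1, b2) $$ (i, j - 1) =
      (\<Sum>l<k. b1 $$ (i, l) * torus_entry k D l * (-1) ^ (k - 1 - l) * b2 $$ (k - 1 - l, j - 1))"
      using True ij by (intro bruhat_entry U_realD b) auto
    thus ?thesis using True by (simp add: sum_negf flip: sum_divide_distrib)
  next
    case False
    thus ?thesis by (simp only: if_False sum.neutral_const)
  qed
  also have "?L $$ (i, k) * of_int r =
      (if i = k then of_int r else if i = k - 1 then s * of_int r else 0)"
    using ij by (simp add: extend_left_def)
  also have "?R $$ (0, j) = (if j = 0 then 1 else if j = 1 then t else 0)"
    using ij by (simp add: extend_right_def)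
  finally show ?thesis by (simp add: tw_def)
qed

section \<open>Clearing the outer column and row\<close>

text \<open>After scaling by \<open>r\<close>, the last column ends in a pivot coprime to
  \<open>r\<close> followed by \<open>r\<close> itself, so integer combinations of the last two rows
  clear the rows above. A multiple of the last row makes the pivot divisible by \<open>d\<close>, as
  \<open>r\<close> and \<open>d\<close> are coprime.\<close>

lemma clear_last_col:
  assumes b: "b \<in> U_real (Suc k)" and k: "k \<ge> 1" and r: "r > 0" and d: "coprime r d"
    and Z: "\<And>i. i < k \<Longrightarrow> b $$ (i, k) * of_int r \<in> \<int>"
    and cop: "\<And>x. b $$ (k - 1, k) * of_int r = of_int x \<Longrightarrow> coprime x r"
  obtains u where "u \<in> U_int (Suc k)" "\<And>i. i < k - 1 \<Longrightarrow> (u * b) $$ (i, k) = 0"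
    "(u * b) $$ (k - 1, k) * of_int r / of_int d \<in> \<int>"
proof -
  define g where "g i = \<lfloor>b $$ (i, k) * of_int r\<rfloor>" for i
  have g: "b $$ (i, k) * of_int r = of_int (g i)" if "i < k" for i
    using Z[OF that] by (simp add: g_def)
  have "coprime (g (k - 1)) r" using k by (intro cop g) simp
  then obtain p q where pq: "\<And>i. g i + p i * g (k - 1) + q i * r = 0"
    using coprime_solve_cong[of "g (k - 1)" r g] by blast
  \<comment> \<open>A single congruence, hence a family indexed by the one-element type.\<close>
  obtain m m' where m: "g (k - 1) + m * r + m' * d = 0"
    using coprime_solve_cong[OF d, of "\<lambda>_ :: unit. g (k - 1)"] by blast
  define u where "u = Matrix.mat (Suc k) (Suc k) (\<lambda>(i, j). if i = j then 1
    else if j = k then of_int (if i = k - 1 then m else q i)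
    else if j = k - 1 \<and> i < k - 1 then real_of_int (p i) else 0)"
  have u: "u \<in> U_int (Suc k)"
    by (auto simp: U_int_iff u_def intro!: U_realI)
  have bk: "b $$ (k, k) = 1" using U_realD(4)[OF b] by simp
  have ub: "(u * b) $$ (i, k) = b $$ (i, k) + (\<Sum>l\<in>{i<..<Suc k}. u $$ (i, l) * b $$ (l, k))" if "i \<le> k" for i
    using U_real_mult_entry[OF U_int_subset[OF u] U_realD(1)[OF b]] that by simp
  show thesis
  proof (rule that[OF u])
    fix i assume i: "i < k - 1"
    have "(\<Sum>l\<in>{i<..<Suc k}. u $$ (i, l) * b $$ (l, k)) = (\<Sum>l\<in>{k - 1, k}. u $$ (i, l) * b $$ (l, k))"
      using i by (intro sum.mono_neutral_right) (auto simp: u_def)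
    also have "\<dots> = of_int (p i) * b $$ (k - 1, k) + of_int (q i)"
      using i bk k by (auto simp: u_def)
    finally have "(u * b) $$ (i, k) = b $$ (i, k) + of_int (p i) * b $$ (k - 1, k) + of_int (q i)"
      using ub[of i] i by simp
    hence "(u * b) $$ (i, k) * of_int r =
        b $$ (i, k) * of_int r + of_int (p i) * (b $$ (k - 1, k) * of_int r) + of_int (q i) * of_int r"
      by (simp add: algebra_simps)
    also have "\<dots> = of_int (g i + p i * g (k - 1) + q i * r)"
      using g[of i] g[of "k - 1"] i by simp
    also have "\<dots> = 0" unfolding pq by simp
    finally show "(u * b) $$ (i, k) = 0" using r by simp
  next
    have "{k - 1<..<Suc k} = {k}" "k - Suc 0 \<noteq> k" using k by auto
    hence "(u * b) $$ (k - 1, k) = b $$ (k - 1, k) + of_int m"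
      using ub[of "k - 1"] bk k by (simp add: u_def)
    hence "(u * b) $$ (k - 1, k) * of_int r = of_int (g (k - 1) + m * r)"
      using g[of "k - 1"] k by (simp add: algebra_simps)
    also have "g (k - 1) + m * r = - m' * d" using m by simp
    finally show "(u * b) $$ (k - 1, k) * of_int r / of_int d \<in> \<int>" by simp
  qed
qed

lemma mult_U_real_entry:
  assumes "B \<in> carrier_mat n m" "v \<in> U_real m" "i < n" "j < m"
  shows "(B * v) $$ (i, j) = (\<Sum>l<j. B $$ (i, l) * v $$ (l, j)) + B $$ (i, j)"
proof -
  have "(B * v) $$ (i, j) = (\<Sum>l<m. B $$ (i, l) * v $$ (l, j))"
    using assms U_realD(1) by (intro mult_entry) auto
  also have "\<dots> = (\<Sum>l<Suc j. B $$ (i, l) * v $$ (l, j))"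
    using assms U_realD[OF assms(2)] by (intro sum.mono_neutral_right) auto
  finally show ?thesis using assms U_realD[OF assms(2)] by simp
qed

text \<open>The transposed elimination: after scaling by \<open>r\<close>, the first row starts with
  \<open>r\<close> and a number coprime to \<open>r\<close>, and combinations of these two columns
  clear the rest.\<close>

lemma clear_first_row:
  assumes b: "b \<in> U_real (Suc k)" and r: "r > 0"
    and Z: "\<And>j. j \<le> k \<Longrightarrow> b $$ (0, j) * of_int r \<in> \<int>"
    and cop: "\<And>y. b $$ (0, 1) * of_int r = of_int y \<Longrightarrow> coprime y r" and k: "k \<ge> 1"
  obtains v where "v \<in> U_int (Suc k)" "\<And>j. 2 \<le> j \<Longrightarrow> j \<le> k \<Longrightarrow> (b * v) $$ (0, j) = 0"
proof -
  define g where "g j = \<lfloor>b $$ (0, j) * of_int r\<rfloor>" for j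
  have g: "b $$ (0, j) * of_int r = of_int (g j)" if "j \<le> k" for j
    using Z[OF that] by (simp add: g_def)
  have "coprime (g 1) r" using k by (intro cop g) simp
  then obtain p q where pq: "\<And>j. g j + p j * g 1 + q j * r = 0"
    using coprime_solve_cong[of "g 1" r g] by blast
  define v where "v = Matrix.mat (Suc k) (Suc k) (\<lambda>(i, j). if i = j then 1
    else if 2 \<le> j \<and> i = 0 then of_int (q j) else if 2 \<le> j \<and> i = 1 then real_of_int (p j) else 0)"
  have v: "v \<in> U_int (Suc k)"
    by (auto simp: U_int_iff v_def intro!: U_realI)
  have b0: "b $$ (0, 0) = 1" using U_realD(4)[OF b] by simp
  have bv: "(b * v) $$ (0, j) = (\<Sum>l<j. b $$ (0, l) * v $$ (l, j)) + b $$ (0, j)" if "j \<le> k" for j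
    using mult_U_real_entry[OF U_realD(1)[OF b] U_int_subset[OF v]] that by simp
  show thesis
  proof (rule that[OF v])
    fix j assume j: "2 \<le> j" "j \<le> k"
    have "(\<Sum>l<j. b $$ (0, l) * v $$ (l, j)) = (\<Sum>l\<in>{0, 1}. b $$ (0, l) * v $$ (l, j))"
      using j by (intro sum.mono_neutral_right) (auto simp: v_def)
    also have "\<dots> = of_int (q j) + b $$ (0, 1) * of_int (p j)"
      using j b0 by (simp add: v_def)
    finally have "(b * v) $$ (0, j) = of_int (q j) + b $$ (0, 1) * of_int (p j) + b $$ (0, j)"
      using bv[of j] j by simp
    hence "(b * v) $$ (0, j) * of_int r =
        b $$ (0, j) * of_int r + of_int (p j) * (b $$ (0, 1) * of_int r) + of_int (q j) * of_int r"
      by (simp add: algebra_simps)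
    also have "\<dots> = of_int (g j + p j * g 1 + q j * r)"
      using g[of j] g[of 1] j by simp
    also have "\<dots> = 0" unfolding pq by simp
    finally show "(b * v) $$ (0, j) = 0" using r by simp
  qed
qed

section \<open>Characters of extended matrices\<close>

text \<open>The left character uses the reversed tuple, so \<open>M ! 0\<close> sits at the bottom
  of the superdiagonal, next to \<open>s\<close>. The entry just above it, paired with
  \<open>M ! 1\<close>, is the only one that the twist scales, by \<open>r\<close>.\<close>

lemma psi_extend_left:
  assumes "length M = k" "k \<ge> 2" "r \<noteq> 0"
  shows "psi (Suc k) (rev M) (extend_left k (of_int r) s b) =
    e (of_int (M ! 0) * s) * psi k (rev ((r * M ! 1) # drop 2 M)) b"
proof -
  let ?E = "extend_left k (of_int r) s b" and ?L = "(r * M ! 1) # drop 2 M"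
  obtain m where m: "k = Suc (Suc m)" using assms(2) by (metis add_2_eq_Suc le_Suc_ex)
  have "of_int (rev M ! i) * ?E $$ (i, i + 1) = of_int (rev ?L ! i) * b $$ (i, i + 1)" if "i < Suc m" for i
  proof (cases "i = m")
    case True
    thus ?thesis using assms by (simp add: m rev_nth extend_left_def twist_def nth_append)
  next
    case False
    hence "i < m" using that by simp
    then obtain d where d: "m = Suc (i + d)" using less_iff_Suc_add by auto
    show ?thesis using assms by (simp add: m d rev_nth extend_left_def twist_def nth_append)
  qed
  hence "(\<Sum>i<Suc m. of_int (rev M ! i) * ?E $$ (i, i + 1)) = (\<Sum>i<Suc m. of_int (rev ?L ! i) * b $$ (i, i + 1))"
    by (intro sum.cong) auto
  moreover have "of_int (rev M ! Suc m) * ?E $$ (Suc m, Suc m + 1) = of_int (M ! 0) * s"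
    using assms by (simp add: m rev_nth extend_left_def)
  ultimately have "(\<Sum>i<Suc k - 1. of_int (rev M ! i) * ?E $$ (i, i + 1)) =
      (\<Sum>i<k - 1. of_int (rev ?L ! i) * b $$ (i, i + 1)) + of_int (M ! 0) * s"
    by (simp only: m sum.lessThan_Suc diff_Suc_1)
  thus ?thesis by (simp add: psi_def e_add)
qed

lemma psi_extend_right:
  assumes "length N = k" "k \<ge> 1"
  shows "psi (Suc k) N (extend_right k t b) = e (of_int (N ! 0) * t) * psi k (tl N) b"
proof -
  let ?E = "extend_right k t b"
  obtain m where m: "k = Suc m" using assms(2) by (cases k) auto
  have "(\<Sum>i<k. of_int (N ! i) * ?E $$ (i, i + 1)) =
      of_int (N ! 0) * t + (\<Sum>i<m. of_int (N ! Suc i) * ?E $$ (Suc i, Suc i + 1))"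
    unfolding m sum.lessThan_Suc_shift by (simp add: extend_right_def)
  also have "(\<Sum>i<m. of_int (N ! Suc i) * ?E $$ (Suc i, Suc i + 1)) = (\<Sum>i<m. of_int (tl N ! i) * b $$ (i, i + 1))"
    using assms by (intro sum.cong) (auto simp: m extend_right_def nth_tl)
  finally show ?thesis by (simp add: psi_def e_add m)
qed

lemma psi_2: "psi 2 [m] a = e (of_int m * a $$ (0, 1))"
  by (simp add: psi_def)

section \<open>Arithmetic of coprime moduli\<close>

text \<open>The integrality condition is \<open>x y \<equiv> d\<close> modulo \<open>r\<close>; a
  common divisor of \<open>x y\<close> and \<open>r\<close> would therefore divide
  \<open>d\<close>.\<close>

lemma coprime_of_mult_sub_mem_Ints:
  fixes x y r d :: int
  assumes "r > 0" "coprime r d" "of_int x * (of_int y / of_int r) - of_int d / of_int r \<in> (\<int> :: real set)"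
  shows "coprime x r" "coprime y r" "r dvd x * y - d"
proof -
  obtain z where "of_int x * (of_int y / of_int r) - of_int d / of_int r = (of_int z :: real)"
    using assms(3) by (auto elim: Ints_cases)
  hence "real_of_int (x * y - d) = of_int (r * z)" using assms(1) by (simp add: field_simps)
  hence *: "x * y - d = r * z" unfolding of_int_eq_iff .
  thus "r dvd x * y - d" by simp
  have "coprime (x * y) r"
  proof (rule coprimeI)
    fix c assume "c dvd x * y" "c dvd r"
    moreover have "d = x * y - r * z" using * by simp
    ultimately have "c dvd d" by simp
    thus "is_unit c" using \<open>c dvd r\<close> assms(2) coprime_common_divisor by blast
  qed
  thus "coprime x r" "coprime y r" by simp_all
qed

lemma coprime_Ints_mult_cancel:
  fixes z :: real
  assumes "coprime a b" "of_int a * z \<in> \<int>" "of_int b * z \<in> \<int>"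
  shows "z \<in> \<int>"
proof -
  obtain s t where "s * a + t * b = 1"
    using bezout_int[of a b] assms(1) by (auto simp: coprime_iff_gcd_eq_1)
  hence "real_of_int (s * a + t * b) = 1" by simp
  hence "z = of_int s * (of_int a * z) + of_int t * (of_int b * z)"
    by (simp flip: distrib_right mult.assoc)
  also have "\<dots> \<in> \<int>" by (intro Ints_add Ints_mult[OF Ints_of_int] assms(2,3))
  finally show ?thesis .
qed

subsection \<open>Splitting off the first modulus\<close>

text \<open>No finiteness is assumed: a sum over an infinite set is \<open>0\<close>, and a product of two sets is infinite
  as soon as one factor is infinite and the other is nonempty.\<close>

lemma sum_class_product:
  fixes F1 :: "'p \<Rightarrow> 'x :: comm_semiring_1"
  assumes lift: "\<And>a b. a \<in> C1 \<Longrightarrow> b \<in> C2 \<Longrightarrow> \<exists>b'\<in>C2. q2 b' = q2 b \<and> J a b' \<in> C3"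
    and surj: "\<And>c. c \<in> C3 \<Longrightarrow> \<exists>a\<in>C1. \<exists>b\<in>C2. J a b \<in> C3 \<and> q3 (J a b) = q3 c"
    and eq: "\<And>a b a' b'. a \<in> C1 \<Longrightarrow> b \<in> C2 \<Longrightarrow> a' \<in> C1 \<Longrightarrow> b' \<in> C2 \<Longrightarrow> J a b \<in> C3 \<Longrightarrow> J a' b' \<in> C3 \<Longrightarrow>
      q3 (J a b) = q3 (J a' b') \<longleftrightarrow> q1 a = q1 a' \<and> q2 b = q2 b'"
    and val: "\<And>a b. a \<in> C1 \<Longrightarrow> b \<in> C2 \<Longrightarrow> J a b \<in> C3 \<Longrightarrow> F3 (q3 (J a b)) = F1 (q1 a) * F2 (q2 b)"
  shows "sum F3 (q3 ` C3) = sum F1 (q1 ` C1) * sum F2 (q2 ` C2)"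
proof -
  \<comment> \<open>\<open>J\<close> need not map every pair of representatives into
    \<open>C3\<close>; \<open>R\<close> keeps those that it does, and by \<open>eq\<close> the class
    reached depends only on the pair of classes.\<close>
  define R where "R p a b \<longleftrightarrow> a \<in> C1 \<and> b \<in> C2 \<and> J a b \<in> C3 \<and> p = (q1 a, q2 b)" for p a b
  define h where "h p = (SOME r. \<exists>a b. R p a b \<and> r = q3 (J a b))" for p
  have h: "h (q1 a, q2 b) = q3 (J a b)" if "a \<in> C1" "b \<in> C2" "J a b \<in> C3" for a b
    unfolding h_def using that by (intro some_equality) (auto simp: R_def eq)
  have rep: "\<exists>a b. R p a b" if "p \<in> q1 ` C1 \<times> q2 ` C2" for p
  proof -
    from that obtain a b where "a \<in> C1" "b \<in> C2" "p = (q1 a, q2 b)" by auto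
    with lift[of a b] show ?thesis unfolding R_def by metis
  qed
  have "bij_betw h (q1 ` C1 \<times> q2 ` C2) (q3 ` C3)"
    unfolding bij_betw_def
  proof (intro conjI inj_onI equalityI subsetI)
    fix p p' assume *: "p \<in> q1 ` C1 \<times> q2 ` C2" "p' \<in> q1 ` C1 \<times> q2 ` C2" "h p = h p'"
    obtain a b a' b' where "R p a b" "R p' a' b'" using rep[OF *(1)] rep[OF *(2)] by blast
    with *(3) show "p = p'" by (simp add: R_def h eq)
  next
    fix r assume "r \<in> h ` (q1 ` C1 \<times> q2 ` C2)"
    then obtain p where p: "p \<in> q1 ` C1 \<times> q2 ` C2" "r = h p" by blast
    obtain a b where "R p a b" using rep[OF p(1)] by blast
    thus "r \<in> q3 ` C3" using p(2) by (simp add: R_def h)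
  next
    fix r assume "r \<in> q3 ` C3"
    then obtain c where c: "c \<in> C3" "r = q3 c" by blast
    obtain a b where ab: "a \<in> C1" "b \<in> C2" "J a b \<in> C3" "q3 (J a b) = q3 c"
      using surj[OF c(1)] by blast
    show "r \<in> h ` (q1 ` C1 \<times> q2 ` C2)"
      using ab c by (intro image_eqI[of _ _ "(q1 a, q2 b)"]) (auto simp: h)
  qed
  hence "sum F3 (q3 ` C3) = (\<Sum>p\<in>q1 ` C1 \<times> q2 ` C2. F3 (h p))"
    by (rule sum.reindex_bij_betw[symmetric])
  also have "\<dots> = (\<Sum>(p, q)\<in>q1 ` C1 \<times> q2 ` C2. F1 p * F2 q)"
  proof (rule sum.cong)
    fix p assume p: "p \<in> q1 ` C1 \<times> q2 ` C2"
    obtain a b where "R p a b" using rep[OF p] by blast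
    thus "F3 (h p) = (case p of (p, q) \<Rightarrow> F1 p * F2 q)" by (simp add: R_def h val)
  qed simp
  also have "\<dots> = sum F1 (q1 ` C1) * sum F2 (q2 ` C2)"
    by (simp add: sum_product sum.cartesian_product)
  finally show ?thesis .
qed

context
  fixes k :: nat and r :: int and D :: "int list"
  assumes k: "k \<ge> 2" and r: "r > 0" and len: "length D = k - 1" and pos: "\<forall>d\<in>set D. d > 0"
    and cop: "coprime r (D ! 0)"
begin

private lemma D_nonempty: "D \<noteq> []"
  using k len by auto

private lemma D_0_pos: "D ! 0 > 0"
  using D_nonempty pos by simp

private lemma len_Cons: "length (r # D) = Suc k - 1"
  using k len by simp

private lemma pos_Cons: "\<forall>d\<in>set (r # D). d > 0"
  using pos r by simp

text \<open>Each conclusion is read off from entries of the large matrix: \<open>s r\<close> and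
  \<open>t r\<close> lie in its first column and last row, and their neighbour at
  \<open>(k - 1, 1)\<close> gives the congruence condition.\<close>

lemma bruhat_pairs_extendD:
  assumes "b1 \<in> U_real k" "b2 \<in> U_real k"
    and P: "(extend_left k (of_int r) s b1, extend_right k t b2) \<in> bruhat_pairs (Suc k) (r # D)"
  shows "(b1, b2) \<in> bruhat_pairs k D" "s * of_int r \<in> \<int>" "t * of_int r \<in> \<int>"
    "s * of_int r * t - of_int (D ! 0) / of_int r \<in> \<int>"
proof -
  let ?g = "bruhat (Suc k) (r # D) (extend_left k (of_int r) s b1, extend_right k t b2)"
  have rn: "r \<noteq> 0" and kk: "k - Suc 0 \<noteq> k" "0 < k" using r k by auto
  note E = bruhat_extend_entry[OF assms(1,2) D_nonempty rn, of _ _ s t]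
  have c: "?g \<in> carrier_mat (Suc k) (Suc k)"
    by (intro bruhat_carrier) (simp_all add: extend_left_def extend_right_def)
  have Z: "?g $$ (i, j) \<in> \<int>" if "i \<le> k" "j \<le> k" for i j
    using P that by (auto simp: bruhat_pairs_def elements_mat_subset_iff[OF c])
  show s: "s * of_int r \<in> \<int>" using Z[of "k - 1" 0] E[of "k - 1" 0] k kk by simp
  show t: "t * of_int r \<in> \<int>" using Z[of k 1] E[of k 1] k by (simp add: mult.commute)
  have last: "bruhat k D (b1, b2) $$ (k - 1, 0) = of_int (D ! 0)"
    using bruhat_last_row[OF assms(1,2), of 0 D] torus_entry_last[of k D] D_nonempty k U_realD(4)[OF assms(2), of 0] by simp
  show "s * of_int r * t - of_int (D ! 0) / of_int r \<in> \<int>"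
    using Z[of "k - 1" 1] E[of "k - 1" 1] k kk last by (simp add: twist_def)
  have bc: "bruhat k D (b1, b2) \<in> carrier_mat k k" by (intro bruhat_carrier U_realD assms)
  have "bruhat k D (b1, b2) $$ (i, j) \<in> \<int>" if ij: "i < k" "j < k" for i j
  proof (cases "i = k - 1")
    case False
    hence "?g $$ (i, Suc j) = - bruhat k D (b1, b2) $$ (i, j)"
      using E[of i "Suc j"] ij by (simp add: twist_def)
    thus ?thesis using Z[of i "Suc j"] ij by (simp add: minus_in_Ints_iff)
  next
    case True
    have "?g $$ (i, Suc j) = - bruhat k D (b1, b2) $$ (i, j) / of_int r + s * of_int r * (if j = 0 then t else 0)"
      using E[of i "Suc j"] ij True by (simp add: twist_def)
    \<comment> \<open>Multiplying by \<open>r\<close> clears the denominator of the twisted row and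
      also makes the correction term in column 0 integral.\<close>
    hence "bruhat k D (b1, b2) $$ (i, j) =
        (s * of_int r) * (if j = 0 then t * of_int r else 0) - of_int r * ?g $$ (i, Suc j)"
      using rn by (auto simp: field_simps)
    also have "\<dots> \<in> \<int>"
      using t ij by (intro Ints_diff Ints_mult[OF s] Ints_mult[OF Ints_of_int] Z) auto
    finally show ?thesis .
  qed
  thus "(b1, b2) \<in> bruhat_pairs k D"
    using assms by (simp add: bruhat_pairs_def elements_mat_subset_iff[OF bc])
qed

text \<open>The last row of the small matrix enters divided by \<open>r\<close>. Its first entry is
  handled by the congruence for \<open>s\<close> and \<open>t\<close>, the others by the
  divisibility assumption \<open>row\<close>.\<close>

lemma bruhat_pairs_extendI:
  assumes P: "(b1, b2) \<in> bruhat_pairs k D"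
    and s: "s * of_int r \<in> \<int>" and t: "t * of_int r \<in> \<int>"
    and st: "s * of_int r * t - of_int (D ! 0) / of_int r \<in> \<int>"
    and row: "\<And>j. 1 \<le> j \<Longrightarrow> j < k \<Longrightarrow> of_int (D ! 0) * b2 $$ (0, j) / of_int r \<in> \<int>"
  shows "(extend_left k (of_int r) s b1, extend_right k t b2) \<in> bruhat_pairs (Suc k) (r # D)"
proof -
  let ?g = "bruhat (Suc k) (r # D) (extend_left k (of_int r) s b1, extend_right k t b2)"
  have b: "b1 \<in> U_real k" "b2 \<in> U_real k" using P by (auto simp: bruhat_pairs_def)
  have rn: "r \<noteq> 0" and kk: "k - Suc 0 \<noteq> k" "0 < k" using r k by auto
  note E = bruhat_extend_entry[OF b D_nonempty rn, of _ _ s t]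
  have c: "?g \<in> carrier_mat (Suc k) (Suc k)"
    by (intro bruhat_carrier) (simp_all add: extend_left_def extend_right_def)
  have bc: "bruhat k D (b1, b2) \<in> carrier_mat k k" by (intro bruhat_carrier U_realD b)
  have Z: "bruhat k D (b1, b2) $$ (i, j) \<in> \<int>" if "i < k" "j < k" for i j
    using P that by (auto simp: bruhat_pairs_def elements_mat_subset_iff[OF bc])
  have last: "bruhat k D (b1, b2) $$ (k - 1, j) = of_int (D ! 0) * b2 $$ (0, j)" if "j < k" for j
    using bruhat_last_row[OF b that, of D] torus_entry_last[of k D] D_nonempty k by simp
  have "?g $$ (i, j) \<in> \<int>" if ij: "i \<le> k" "j \<le> k" for i j
  proof -
    have "i = k \<or> i = k - 1 \<or> i < k - 1" "j = 0 \<or> j = 1 \<or> 2 \<le> j" using ij by linarith+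
    then consider "i = k" | "i = k - 1" "j = 0" | "i = k - 1" "j = 1" | "i = k - 1" "2 \<le> j" | "i < k - 1"
      by blast
    thus ?thesis
    proof cases
      case 1
      thus ?thesis using E[OF ij] t by (simp add: mult.commute)
    next
      case 2
      thus ?thesis using E[OF ij] s k kk by simp
    next
      case 3
      thus ?thesis using E[OF ij] st k kk last[of 0] U_realD(4)[OF b(2), of 0] by (simp add: twist_def)
    next
      case 4
      thus ?thesis using E[OF ij] row[of "j - 1"] k kk ij last[of "j - 1"] by (simp add: twist_def minus_in_Ints_iff)
    next
      case 5
      thus ?thesis using E[OF ij] Z[of i "j - 1"] ij by (auto simp: twist_def minus_in_Ints_iff)
    qed
  qed
  thus ?thesis
    using b extend_left_U_real[OF b(1), of "of_int r" s] extend_right_U_real[OF b(2), of t] rn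
    by (simp add: bruhat_pairs_def elements_mat_subset_iff[OF c])
qed

section \<open>Gluing the two cells\<close>

text \<open>The factor \<open>D ! 0\<close> turns a solution of \<open>w y \<equiv> 1\<close> modulo
  \<open>r\<close> into one of \<open>x y \<equiv> D ! 0\<close> with \<open>x = D ! 0 * w\<close>,
  the congruence required in the large cell.\<close>

definition glue :: "real mat \<times> real mat \<Rightarrow> real mat \<times> real mat \<Rightarrow> real mat \<times> real mat" where
  "glue a b = (extend_left k (of_int r) (of_int (D ! 0) * fst a $$ (0, 1)) (fst b),
     extend_right k (snd a $$ (0, 1)) (snd b))"

text \<open>Only representatives whose last block row is divisible by \<open>r\<close> beyond column
  0 can be glued. That row starts with \<open>D ! 0\<close>, which is coprime to \<open>r\<close>,
  so adding multiples of the first column achieves this within the class.\<close>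

lemma glue_lift:
  assumes a: "(a1, a2) \<in> bruhat_pairs 2 [r]" and b: "(b1, b2) \<in> bruhat_pairs k D"
  shows "\<exists>b'\<in>bruhat_pairs k D. bruhat_class k D b' = bruhat_class k D (b1, b2) \<and>
    glue (a1, a2) b' \<in> bruhat_pairs (Suc k) (r # D)"
proof -
  define d where "d = D ! 0"
  have bU: "b1 \<in> U_real k" "b2 \<in> U_real k" using b by (auto simp: bruhat_pairs_def)
  have bc: "bruhat k D (b1, b2) \<in> carrier_mat k k" by (intro bruhat_carrier U_realD bU)
  define g where "g j = \<lfloor>of_int d * b2 $$ (0, j)\<rfloor>" for j
  have g: "of_int d * b2 $$ (0, j) = of_int (g j)" if "j < k" for j
  proof -
    have "bruhat k D (b1, b2) $$ (k - 1, j) \<in> \<int>"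
      using b that k by (simp add: bruhat_pairs_def elements_mat_subset_iff[OF bc])
    thus ?thesis
      using bruhat_last_row[OF bU that, of D] torus_entry_last[of k D] D_nonempty k by (simp add: g_def d_def)
  qed
  obtain p q where pq: "\<And>j. g j + p j * d + q j * r = 0"
    using coprime_solve_cong[of d r g] cop by (auto simp: coprime_commute d_def)
  define v where "v = Matrix.mat k k (\<lambda>(i, j). if i = j then 1 else if i = 0 then real_of_int (p j) else 0)"
  have v: "v \<in> U_int k" by (auto simp: U_int_iff v_def intro!: U_realI)
  have row: "of_int d * (b2 * v) $$ (0, j) / of_int r \<in> \<int>" if j: "1 \<le> j" "j < k" for j
  proof -
    have "(b2 * v) $$ (0, j) = (\<Sum>l<j. b2 $$ (0, l) * v $$ (l, j)) + b2 $$ (0, j)"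
      using mult_U_real_entry[OF U_realD(1)[OF bU(2)] U_int_subset[OF v], of 0 j] j k by simp
    also have "(\<Sum>l<j. b2 $$ (0, l) * v $$ (l, j)) = (\<Sum>l\<in>{0}. b2 $$ (0, l) * v $$ (l, j))"
      using j by (intro sum.mono_neutral_right) (auto simp: v_def)
    also have "\<dots> = of_int (p j)" using j U_realD(4)[OF bU(2), of 0] by (simp add: v_def)
    finally have "of_int d * (b2 * v) $$ (0, j) = of_int (g j + p j * d)"
      using g[OF j(2)] by (simp add: algebra_simps)
    also have "g j + p j * d = - q j * r" using pq[of j] by simp
    finally show ?thesis using r by simp
  qed
  have one: "1\<^sub>m k * b1 = b1" using left_mult_one_mat[OF U_realD(1)[OF bU(1)]] .
  note tr = bruhat_pairs_translate[OF len pos b U_int_one v, unfolded one]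
  define s t where "s = a1 $$ (0, 1)" and "t = a2 $$ (0, 1)"
  have st: "s * of_int r \<in> \<int>" "t * of_int r \<in> \<int>" "s * t * of_int r - 1 / of_int r \<in> \<int>"
    using a unfolding bruhat_pairs_2 s_def t_def by auto
  have "(extend_left k (of_int r) (of_int d * s) b1, extend_right k t (b2 * v)) \<in> bruhat_pairs (Suc k) (r # D)"
  proof (rule bruhat_pairs_extendI[OF tr(1)])
    have "of_int d * (s * of_int r) \<in> \<int>" by (intro Ints_mult[OF Ints_of_int] st)
    thus "of_int d * s * of_int r \<in> \<int>" by (simp add: mult.assoc)
    have "of_int d * (s * t * of_int r - 1 / of_int r) \<in> \<int>" by (intro Ints_mult[OF Ints_of_int] st)
    thus "of_int d * s * of_int r * t - of_int (D ! 0) / of_int r \<in> \<int>"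
      by (simp add: d_def algebra_simps)
  qed (use st row in \<open>auto simp: d_def\<close>)
  hence "glue (a1, a2) (b1, b2 * v) \<in> bruhat_pairs (Suc k) (r # D)"
    by (simp add: glue_def s_def t_def d_def)
  thus ?thesis using tr by blast
qed

text \<open>The entry at \<open>(k - 1, 1)\<close> equals \<open>(x y - D ! 0) / r\<close>, where
  \<open>x\<close> and \<open>y\<close> are the first-column and last-row neighbours of the corner
  \<open>r\<close>; its integrality gives both coprimalities.\<close>

lemma bruhat_pairs_Cons_coprime:
  assumes c: "(c1, c2) \<in> bruhat_pairs (Suc k) (r # D)"
  shows "i < k \<Longrightarrow> c1 $$ (i, k) * of_int r \<in> \<int>" "j \<le> k \<Longrightarrow> c2 $$ (0, j) * of_int r \<in> \<int>"
    "c1 $$ (k - 1, k) * of_int r = of_int x \<Longrightarrow> coprime x r"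
    "c2 $$ (0, 1) * of_int r = of_int y \<Longrightarrow> coprime y r"
proof -
  have cU: "c1 \<in> U_real (Suc k)" "c2 \<in> U_real (Suc k)" using c by (auto simp: bruhat_pairs_def)
  let ?g = "bruhat (Suc k) (r # D) (c1, c2)"
  let ?te = "torus_entry (Suc k) (r # D)"
  have gc: "?g \<in> carrier_mat (Suc k) (Suc k)" by (intro bruhat_carrier U_realD cU)
  have Z: "?g $$ (i, j) \<in> \<int>" if "i \<le> k" "j \<le> k" for i j
    using c that by (auto simp: bruhat_pairs_def elements_mat_subset_iff[OF gc])
  have te: "?te k = of_int r" using torus_entry_last[of "Suc k" "r # D"] by simp
  have col: "c1 $$ (i, k) * of_int r \<in> \<int>" if "i < k" for i
    using bruhat_first_col[OF cU, of i "r # D"] Z[of i 0] that te by simp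
  have row: "c2 $$ (0, j) * of_int r \<in> \<int>" if "j \<le> k" for j
    using bruhat_last_row[OF cU, of j "r # D"] Z[of k j] that te by (simp add: mult.commute)
  show "i < k \<Longrightarrow> c1 $$ (i, k) * of_int r \<in> \<int>" "j \<le> k \<Longrightarrow> c2 $$ (0, j) * of_int r \<in> \<int>"
    by (fact col, fact row)
  have te': "?te (k - 1) = of_int (D ! 0) / of_int r"
    using torus_entry_Cons[of "k - 1" k D r] torus_entry_last[of k D] D_nonempty k r
    by (simp add: twist_def field_simps)
  have "?g $$ (k - 1, 1) = (\<Sum>l<Suc k. c1 $$ (k - 1, l) * ?te l * (-1) ^ (k - l) * c2 $$ (k - l, 1))"
    using bruhat_entry[OF U_realD(1)[OF cU(1)] U_realD(1)[OF cU(2)], of "k - 1" 1 "r # D"] k by simp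
  \<comment> \<open>Row \<open>k - 1\<close> of the unipotent \<open>c1\<close> is supported on its
    last two columns.\<close>
  also have "\<dots> = (\<Sum>l\<in>{k - 1, k}. c1 $$ (k - 1, l) * ?te l * (-1) ^ (k - l) * c2 $$ (k - l, 1))"
    using U_realD(5)[OF cU(1), of _ "k - 1"] by (intro sum.mono_neutral_right) auto
  also have "\<dots> = c1 $$ (k - 1, k) * of_int r * c2 $$ (0, 1) - of_int (D ! 0) / of_int r"
    using k te te' U_realD(4)[OF cU(1), of "k - 1"] U_realD(4)[OF cU(2), of 1] by auto
  finally have main: "c1 $$ (k - 1, k) * of_int r * c2 $$ (0, 1) - of_int (D ! 0) / of_int r \<in> \<int>"
    using Z[of "k - 1" 1] k by simp
  obtain x' where x': "c1 $$ (k - 1, k) * of_int r = of_int x'"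
    using col[of "k - 1"] k by (auto elim: Ints_cases)
  obtain y' where y': "c2 $$ (0, 1) * of_int r = of_int y'"
    using row[of 1] k by (auto elim: Ints_cases)
  have "c2 $$ (0, 1) = of_int y' / of_int r" using y' r by (simp add: field_simps)
  with main x' have "of_int x' * (of_int y' / of_int r) - of_int (D ! 0) / of_int r \<in> (\<int> :: real set)"
    by simp
  note * = coprime_of_mult_sub_mem_Ints[OF r cop this]
  show "coprime x r" if "c1 $$ (k - 1, k) * of_int r = of_int x"
    using that *(1) unfolding x' of_int_eq_iff by simp
  show "coprime y r" if "c2 $$ (0, 1) * of_int r = of_int y"
    using that *(2) unfolding y' of_int_eq_iff by simp
qed

text \<open>Elimination by integral unipotents brings any cell element into extended form without
  changing its class, with \<open>s * r\<close> divisible by \<open>D ! 0\<close>. The quotient and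
  \<open>t\<close> then form the element of the cell of size 2.\<close>

lemma glue_surj:
  assumes c: "(c1, c2) \<in> bruhat_pairs (Suc k) (r # D)"
  shows "\<exists>a\<in>bruhat_pairs 2 [r]. \<exists>b\<in>bruhat_pairs k D. glue a b \<in> bruhat_pairs (Suc k) (r # D) \<and>
    bruhat_class (Suc k) (r # D) (glue a b) = bruhat_class (Suc k) (r # D) (c1, c2)"
proof -
  have cU: "c1 \<in> U_real (Suc k)" "c2 \<in> U_real (Suc k)" using c by (auto simp: bruhat_pairs_def)
  note cc = bruhat_pairs_Cons_coprime[OF c]
  have k1: "k \<ge> 1" and rn: "real_of_int r \<noteq> 0" using k r by auto
  obtain u where u: "u \<in> U_int (Suc k)" "\<And>i. i < k - 1 \<Longrightarrow> (u * c1) $$ (i, k) = 0"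
      "(u * c1) $$ (k - 1, k) * of_int r / of_int (D ! 0) \<in> \<int>"
    using clear_last_col[OF cU(1) k1 r cop cc(1) cc(3)] by blast
  obtain v where v: "v \<in> U_int (Suc k)" "\<And>j. 2 \<le> j \<Longrightarrow> j \<le> k \<Longrightarrow> (c2 * v) $$ (0, j) = 0"
    using clear_first_row[OF cU(2) r cc(2) cc(4) k1] by blast
  define s t where "s = (u * c1) $$ (k - 1, k)" and "t = (c2 * v) $$ (0, 1)"
  obtain b1 where b1: "b1 \<in> U_real k" "u * c1 = extend_left k (of_int r) s b1"
    using extend_left_of_U_real[OF U_real_mult[OF U_int_subset[OF u(1)] cU(1)] u(2) rn k1]
    unfolding s_def by blast
  obtain b2 where b2: "b2 \<in> U_real k" "c2 * v = extend_right k t b2"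
    using extend_right_of_U_real[OF U_real_mult[OF cU(2) U_int_subset[OF v(1)]] v(2)]
    unfolding t_def by blast
  note tr = bruhat_pairs_translate[OF len_Cons pos_Cons c u(1) v(1), unfolded b1(2) b2(2)]
  note ext = bruhat_pairs_extendD[OF b1(1) b2(1) tr(1)]
  define a where "a = (shear (s / of_int (D ! 0)), shear t)"
  have "s / of_int (D ! 0) * of_int r \<in> \<int>" using u(3) by (simp add: s_def)
  then obtain w where w: "s / of_int (D ! 0) * of_int r = of_int w" by (auto elim: Ints_cases)
  obtain y where y: "t * of_int r = of_int y" using ext(3) by (auto elim: Ints_cases)
  have x: "s * of_int r = of_int (D ! 0 * w)" using w D_0_pos by (simp add: field_simps)
  have t: "t = of_int y / of_int r" using y rn by (simp add: field_simps)
  have "r dvd D ! 0 * w * y - D ! 0"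
    using coprime_of_mult_sub_mem_Ints(3)[OF r cop ext(4)[unfolded x t]] .
  moreover have "D ! 0 * w * y - D ! 0 = D ! 0 * (w * y - 1)" by (simp add: algebra_simps)
  \<comment> \<open>The factor \<open>D ! 0\<close> is invertible modulo \<open>r\<close> and
    cancels.\<close>
  ultimately have "r dvd w * y - 1" using cop by (simp add: coprime_dvd_mult_right_iff)
  then obtain z where "w * y - 1 = r * z" by blast
  hence "real_of_int (w * y - 1) = of_int (r * z)" by simp
  moreover have "s / of_int (D ! 0) * t * of_int r - 1 / of_int r = of_int (w * y - 1) / of_int r"
  proof -
    have "s / of_int (D ! 0) * t * of_int r = s / of_int (D ! 0) * of_int r * t"
      by (simp only: mult_ac)
    also have "\<dots> = of_int w * t" unfolding w ..
    finally have "s / of_int (D ! 0) * t * of_int r = of_int w * t" .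
    thus ?thesis by (simp add: t diff_divide_distrib)
  qed
  ultimately have "s / of_int (D ! 0) * t * of_int r - 1 / of_int r \<in> \<int>" using rn by simp
  hence "a \<in> bruhat_pairs 2 [r]"
    using w y by (simp add: a_def bruhat_pairs_2 shear_U_real shear_entry)
  moreover have "glue a (b1, b2) = (extend_left k (of_int r) s b1, extend_right k t b2)"
    using D_0_pos by (simp add: glue_def a_def shear_entry)
  ultimately show ?thesis using ext(1) tr by metis
qed

text \<open>Classes are compared through the left factors alone, and
  \<open>extend_left_translate\<close> separates the two data.\<close>

lemma glue_class_eq_iff:
  assumes a: "(a1, a2) \<in> bruhat_pairs 2 [r]" "(a1', a2') \<in> bruhat_pairs 2 [r]"
    and b: "(b1, b2) \<in> bruhat_pairs k D" "(b1', b2') \<in> bruhat_pairs k D"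
    and g: "glue (a1, a2) (b1, b2) \<in> bruhat_pairs (Suc k) (r # D)"
      "glue (a1', a2') (b1', b2') \<in> bruhat_pairs (Suc k) (r # D)"
  shows "bruhat_class (Suc k) (r # D) (glue (a1, a2) (b1, b2)) =
      bruhat_class (Suc k) (r # D) (glue (a1', a2') (b1', b2')) \<longleftrightarrow>
    bruhat_class 2 [r] (a1, a2) = bruhat_class 2 [r] (a1', a2') \<and>
    bruhat_class k D (b1, b2) = bruhat_class k D (b1', b2')"
proof -
  define s s' where "s = a1 $$ (0, 1)" and "s' = a1' $$ (0, 1)"
  let ?d = "real_of_int (D ! 0)"
  have k1: "k \<ge> 1" using k by simp
  have aU: "a1 \<in> U_real 2" "a1' \<in> U_real 2" and aZ: "s * of_int r \<in> \<int>" "s' * of_int r \<in> \<int>"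
    using a by (auto simp: bruhat_pairs_2 s_def s'_def)
  have bU: "b1 \<in> U_real k" "b1' \<in> U_real k" using b by (auto simp: bruhat_pairs_def)
  have dsZ: "?d * s * of_int r \<in> \<int>"
    using Ints_mult[OF Ints_of_int[of "D ! 0"] aZ(1)] by (simp add: mult.assoc)
  have dcop: "coprime x r" if "?d * s * of_int r = of_int x" for x
  proof (rule bruhat_pairs_Cons_coprime(3))
    show "(fst (glue (a1, a2) (b1, b2)), snd (glue (a1, a2) (b1, b2))) \<in> bruhat_pairs (Suc k) (r # D)"
      using g(1) by simp
    show "fst (glue (a1, a2) (b1, b2)) $$ (k - 1, k) * of_int r = of_int x"
      using that k by (auto simp: glue_def extend_left_def s_def)
  qed
  have "bruhat_class (Suc k) (r # D) (glue (a1, a2) (b1, b2)) =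
      bruhat_class (Suc k) (r # D) (glue (a1', a2') (b1', b2')) \<longleftrightarrow>
    (\<exists>u\<in>U_int (Suc k). extend_left k (of_int r) (?d * s') b1' = u * extend_left k (of_int r) (?d * s) b1)"
    using g unfolding glue_def fst_conv snd_conv s_def s'_def
    by (intro bruhat_class_eq_iff[OF len_Cons pos_Cons]) auto
  also have "\<dots> \<longleftrightarrow> ?d * s' - ?d * s \<in> \<int> \<and> (\<exists>u\<in>U_int k. b1' = u * b1)"
    by (rule extend_left_translate[OF bU k1 r dsZ dcop])
  \<comment> \<open>Since \<open>r * (s' - s)\<close> is an integer as well and \<open>r\<close> is
    coprime to \<open>D ! 0\<close>, integrality survives cancelling \<open>D ! 0\<close>.\<close>
  also have "?d * s' - ?d * s \<in> \<int> \<longleftrightarrow> s' - s \<in> \<int>"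
  proof
    assume "?d * s' - ?d * s \<in> \<int>"
    hence "?d * (s' - s) \<in> \<int>" by (simp add: algebra_simps)
    moreover have "of_int r * (s' - s) \<in> \<int>" using Ints_diff[OF aZ(2,1)] by (simp add: algebra_simps)
    ultimately show "s' - s \<in> \<int>" using coprime_Ints_mult_cancel[OF cop] by blast
  next
    assume "s' - s \<in> \<int>"
    hence "?d * (s' - s) \<in> \<int>" by (rule Ints_mult[OF Ints_of_int])
    thus "?d * s' - ?d * s \<in> \<int>" by (simp add: algebra_simps)
  qed
  also have "s' - s \<in> \<int> \<longleftrightarrow> bruhat_class 2 [r] (a1, a2) = bruhat_class 2 [r] (a1', a2')"
    unfolding s_def s'_def U_int_2_translate_iff[OF aU, symmetric]
    using r by (intro bruhat_class_eq_iff[symmetric] a) auto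
  also have "(\<exists>u\<in>U_int k. b1' = u * b1) \<longleftrightarrow> bruhat_class k D (b1, b2) = bruhat_class k D (b1', b2')"
    by (intro bruhat_class_eq_iff[symmetric] len pos k1 b)
  finally show ?thesis .
qed

lemma glue_coset_term:
  assumes a: "(a1, a2) \<in> bruhat_pairs 2 [r]" and b: "(b1, b2) \<in> bruhat_pairs k D"
    and g: "glue (a1, a2) (b1, b2) \<in> bruhat_pairs (Suc k) (r # D)"
    and M: "length M = k" and N: "length N = k"
  shows "coset_term (Suc k) M N (r # D) (bruhat_class (Suc k) (r # D) (glue (a1, a2) (b1, b2))) =
    coset_term 2 [D ! 0 * M ! 0] [N ! 0] [r] (bruhat_class 2 [r] (a1, a2)) *
    coset_term k ((r * M ! 1) # drop 2 M) (tl N) D (bruhat_class k D (b1, b2))"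
proof -
  have "coset_term 2 [D ! 0 * M ! 0] [N ! 0] [r] (bruhat_class 2 [r] (a1, a2)) =
      psi 2 (rev [D ! 0 * M ! 0]) a1 * psi 2 [N ! 0] a2"
    using r by (intro coset_term_bruhat_class a) auto
  moreover have "coset_term (Suc k) M N (r # D) (bruhat_class (Suc k) (r # D) (glue (a1, a2) (b1, b2))) =
      psi (Suc k) (rev M) (extend_left k (of_int r) (of_int (D ! 0) * a1 $$ (0, 1)) b1) *
      psi (Suc k) N (extend_right k (a2 $$ (0, 1)) b2)"
    using g unfolding glue_def fst_conv snd_conv
    by (intro coset_term_bruhat_class[OF len_Cons pos_Cons])
  ultimately show ?thesis
    using psi_extend_left[OF M k, of r] psi_extend_right[OF N, of "a2 $$ (0, 1)" b2] r k
    by (simp add: coset_term_bruhat_class[OF len pos b] psi_2 mult_ac)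
qed

text \<open>All three sums run over classes of pairs, so \<open>sum_class_product\<close> applies
  with \<open>glue\<close> as the joining map.\<close>

lemma kloosterman_Cons:
  assumes "length M = k" "length N = k"
  shows "kloosterman (Suc k) M N (r # D) =
    kloosterman 2 [D ! 0 * M ! 0] [N ! 0] [r] *
    kloosterman k ((r * M ! 1) # drop 2 M) (tl N) D"
proof -
  have "kloosterman 2 [D ! 0 * M ! 0] [N ! 0] [r] = sum (coset_term 2 [D ! 0 * M ! 0] [N ! 0] [r])
      (bruhat_class 2 [r] ` bruhat_pairs 2 [r])"
    using r by (intro kloosterman_eq_sum) auto
  moreover have "kloosterman k ((r * M ! 1) # drop 2 M) (tl N) D =
      sum (coset_term k ((r * M ! 1) # drop 2 M) (tl N) D) (bruhat_class k D ` bruhat_pairs k D)"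
    using k by (intro kloosterman_eq_sum len pos) auto
  moreover have "kloosterman (Suc k) M N (r # D) =
      sum (coset_term (Suc k) M N (r # D)) (bruhat_class (Suc k) (r # D) ` bruhat_pairs (Suc k) (r # D))"
    by (intro kloosterman_eq_sum len_Cons pos_Cons) auto
  moreover have "sum (coset_term (Suc k) M N (r # D)) (bruhat_class (Suc k) (r # D) ` bruhat_pairs (Suc k) (r # D)) =
      sum (coset_term 2 [D ! 0 * M ! 0] [N ! 0] [r]) (bruhat_class 2 [r] ` bruhat_pairs 2 [r]) *
      sum (coset_term k ((r * M ! 1) # drop 2 M) (tl N) D) (bruhat_class k D ` bruhat_pairs k D)"
  proof (rule sum_class_product[where J = glue])
    fix a b assume "a \<in> bruhat_pairs 2 [r]" "b \<in> bruhat_pairs k D"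
    thus "\<exists>b'\<in>bruhat_pairs k D. bruhat_class k D b' = bruhat_class k D b \<and>
        glue a b' \<in> bruhat_pairs (Suc k) (r # D)"
      using glue_lift[of "fst a" "snd a" "fst b" "snd b"] by simp
  next
    fix c assume "c \<in> bruhat_pairs (Suc k) (r # D)"
    thus "\<exists>a\<in>bruhat_pairs 2 [r]. \<exists>b\<in>bruhat_pairs k D. glue a b \<in> bruhat_pairs (Suc k) (r # D) \<and>
        bruhat_class (Suc k) (r # D) (glue a b) = bruhat_class (Suc k) (r # D) c"
      using glue_surj[of "fst c" "snd c"] by simp
  next
    fix a b a' b'
    assume "a \<in> bruhat_pairs 2 [r]" "b \<in> bruhat_pairs k D" "a' \<in> bruhat_pairs 2 [r]" "b' \<in> bruhat_pairs k D"
      "glue a b \<in> bruhat_pairs (Suc k) (r # D)" "glue a' b' \<in> bruhat_pairs (Suc k) (r # D)"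
    thus "bruhat_class (Suc k) (r # D) (glue a b) = bruhat_class (Suc k) (r # D) (glue a' b') \<longleftrightarrow>
        bruhat_class 2 [r] a = bruhat_class 2 [r] a' \<and> bruhat_class k D b = bruhat_class k D b'"
      using glue_class_eq_iff[of "fst a" "snd a" "fst a'" "snd a'" "fst b" "snd b" "fst b'" "snd b'"]
      by simp
  next
    fix a b
    assume "a \<in> bruhat_pairs 2 [r]" "b \<in> bruhat_pairs k D" "glue a b \<in> bruhat_pairs (Suc k) (r # D)"
    thus "coset_term (Suc k) M N (r # D) (bruhat_class (Suc k) (r # D) (glue a b)) =
        coset_term 2 [D ! 0 * M ! 0] [N ! 0] [r] (bruhat_class 2 [r] a) *
        coset_term k ((r * M ! 1) # drop 2 M) (tl N) D (bruhat_class k D b)"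
      using glue_coset_term[of "fst a" "snd a" "fst b" "snd b", OF _ _ _ assms] by simp
  qed
  ultimately show ?thesis by simp
qed

end

theorem corollary3p10:
  fixes n :: nat and M N D :: "int list"
  assumes "n \<ge> 3"
    and "length M = n - 1" and "length N = n - 1" and "length D = n - 1"
    and "\<forall>d \<in> set D. d > 0"
    and "gcd (D ! 0) (prod_list (tl D)) = 1"
  shows "kloosterman n M N D =
           kloosterman 2 [D ! 1 * M ! 0] [N ! 0] [D ! 0] *
           kloosterman (n - 1) ((D ! 0 * M ! 1) # drop 2 M) (tl N) (tl D)"
proof -
  define k where "k = n - 1"
  have n: "n = Suc k" and k: "k \<ge> 2" using assms(1) by (auto simp: k_def)
  obtain r d E where D: "D = r # d # E"
    using assms(4) k by (cases D; cases "tl D") (auto simp: n)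
  have "coprime r (prod_list (d # E))" using assms(6) by (simp add: D coprime_iff_gcd_eq_1)
  hence "coprime r ((d # E) ! 0)" by simp
  from kloosterman_Cons[OF k _ _ _ this, of M N] show ?thesis
    using assms by (simp add: n D)
qed

end
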